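(* Let $(M,\mathcal T,\Phi)$ be a weighted triangulated surface with $M$ connected, let $\alpha\in\mathbb R$, and suppose $\alpha\chi(M)\le 0$. Then there exists a constant $\alpha$-curvature metric on $(M,\mathcal T,\Phi)$ if and only if there exists a circle packing metric $r^*\in\mathbb R^N_{>0}$ such that for every nonempty proper subset $I$ of $V$, $$2\pi\chi(M)\,\frac{\sum_{i\in I}(r_i^{*})^{\alpha}}{\|r^*\|_\alpha^\alpha}>-\sum_{(e,v)\in Lk(I)}(\pi-\Phi(e))+2\pi\chi(F_I).$$
   Context: $M$ is a closed surface with a triangulation $\mathcal T=\{V,E,F\}$ (vertices, edges, faces), $V=\{1,\dots,N\}$, and $\Phi:E\to[0,\pi/2]$ is a weight, $\Phi_{ij}$ being its value on the edge $\{ij\}$; $(M,\mathcal T,\Phi)$ is called a weighted triangulated surface. $\chi$ denotes the Euler characteristic. A circle packing metric is a map $r:V\to(0,+\infty)$, i.e. $r=(r_1,\dots,r_N)\in\mathbb R^N_{>0}$. It gives each edge $\{ij\}$ the length $l_{ij}=\sqrt{r_i^2+r_j^2+2r_ir_j\cos\Phi_{ij}}$; for each face $\{ijk\}$ the three lengths satisfy the strict triangle inequalities, so the face is realized as a Euclidean triangle; $\theta_i^{jk}$ denotes its inner angle at $i$. The classical discrete Gauss curvature is $K_i=2\pi-\sum_{\{ijk\}\in F}\theta_i^{jk}$ (sum over all triangles having $i$ as a vertex). For $\alpha\in\mathbb R$, the $\alpha$-curvature at $i$ is $R_{\alpha,i}=K_i/r_i^\alpha$; $r$ is a constant $\alpha$-curvature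 metric if $R_{\alpha,i}$ does not depend on $i$. Write $\|r\|_\alpha^\alpha=\sum_{i=1}^N r_i^\alpha$. For a proper subset $I\subset V$, $F_I$ is the subcomplex of $\mathcal T$ consisting of all simplices whose vertices are all in $I$, and $Lk(I)$ is the set of pairs $(e,v)$ of an edge $e$ and a vertex $v$ such that (1) the end points of $e$ are not in $I$; (2) $v\in I$; (3) $e$ and $v$ form a triangle of $\mathcal T$. *)

theory Defs
  imports "HOL-Analysis.Analysis"
begin

definition closed_surface :: "'m topology \<Rightarrow> bool" where
  "closed_surface M \<longleftrightarrow>
     topspace M \<noteq> {} \<and> compact_space M \<and> Hausdorff_space M \<and>
     (\<forall>x\<in>topspace M. \<exists>U (W :: (real^2) set).
        openin M U \<and> x \<in> U \<and> open W \<and> subtopology M U homeomorphic_space top_of_set W)"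

text \<open>
  The vertex set \<open>V = {1, ..., N}\<close> is a finite type \<open>'v\<close> (so \<open>N = CARD('v)\<close>). A simplex is
  identified with its nonempty set of vertices, and a triangulation with the abstract simplicial
  complex of its simplices, every element of \<open>'v\<close> being a vertex. In a simplicial complex of
  dimension at most two the simplices are exactly the vertices, the edges and the faces.
\<close>

definition complex2 :: "'v::finite set set \<Rightarrow> bool" where
  "complex2 T \<longleftrightarrow>
     (\<forall>s\<in>T. s \<noteq> {} \<and> card s \<le> 3) \<and>
     (\<forall>s\<in>T. \<forall>t. t \<noteq> {} \<and> t \<subseteq> s \<longrightarrow> t \<in> T) \<and>
     (\<forall>v. {v} \<in> T)"

definition edges :: "'v set set \<Rightarrow> 'v set set" where
  "edges T = {e \<in> T. card e = 2}"

definition faces :: "'v set set \<Rightarrow> 'v set set" where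
  "faces T = {f \<in> T. card f = 3}"

text \<open>The vertex \<open>i\<close> is placed at the \<open>i\<close>-th standard basis vector.\<close>

definition realization :: "'v::finite set set \<Rightarrow> (real^'v) set" where
  "realization T = (\<Union>s\<in>T. convex hull ((\<lambda>i. axis i 1) ` s))"

definition triangulates :: "'v::finite set set \<Rightarrow> 'm topology \<Rightarrow> bool" where
  "triangulates T M \<longleftrightarrow> complex2 T \<and> top_of_set (realization T) homeomorphic_space M"

text \<open>
  Only the values of the weight on the edges of \<open>T\<close> are constrained, and only these are used.
\<close>

definition weighted_triangulated_surface ::
    "'m topology \<Rightarrow> 'v::finite set set \<Rightarrow> ('v set \<Rightarrow> real) \<Rightarrow> bool" where
  "weighted_triangulated_surface M T \<Phi> \<longleftrightarrow>
     closed_surface M \<and> triangulates T M \<and> (\<forall>e\<in>edges T. 0 \<le> \<Phi> e \<and> \<Phi> e \<le> pi / 2)"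

text \<open>
  The Euler characteristic of a finite complex, the alternating sum of the numbers of simplices of
  each dimension. For a triangulated surface \<open>M\<close>, \<open>\<chi>(M)\<close> is that of its triangulation.
\<close>

definition euler_char :: "'v set set \<Rightarrow> int" where
  "euler_char C = (\<Sum>s\<in>C. (-1) ^ (card s - 1))"

definition full_subcomplex :: "'v set set \<Rightarrow> 'v set \<Rightarrow> 'v set set" where
  "full_subcomplex T I = {s \<in> T. s \<subseteq> I}"

definition Lk :: "'v set set \<Rightarrow> 'v set \<Rightarrow> ('v set \<times> 'v) set" where
  "Lk T I = {(e, v). e \<in> edges T \<and> e \<inter> I = {} \<and> v \<in> I \<and> insert v e \<in> faces T}"

definition circle_packing_metric :: "real^'v \<Rightarrow> bool" where
  "circle_packing_metric r \<longleftrightarrow> (\<forall>i. 0 < r $ i)"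

definition edge_length :: "('v set \<Rightarrow> real) \<Rightarrow> real^'v \<Rightarrow> 'v \<Rightarrow> 'v \<Rightarrow> real" where
  "edge_length \<Phi> r i j = sqrt ((r $ i)\<^sup>2 + (r $ j)\<^sup>2 + 2 * r $ i * r $ j * cos (\<Phi> {i, j}))"

text \<open>
  The inner angle of a Euclidean triangle between the sides of lengths \<open>b\<close> and \<open>c\<close>, where \<open>a\<close> is
  the length of the opposite side. See \<open>inner_angle_dist\<close> below.
\<close>

definition inner_angle :: "real \<Rightarrow> real \<Rightarrow> real \<Rightarrow> real" where
  "inner_angle b c a = arccos ((b\<^sup>2 + c\<^sup>2 - a\<^sup>2) / (2 * b * c))"

lemma inner_angle_dist:
  fixes A B C :: "real^2"
  shows "inner_angle (dist A B) (dist A C) (dist B C) =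
           arccos ((B - A) \<bullet> (C - A) / (norm (B - A) * norm (C - A)))"
proof -
  have "(norm (B - A))\<^sup>2 + (norm (C - A))\<^sup>2 - (norm (B - C))\<^sup>2 = 2 * ((B - A) \<bullet> (C - A))"
    by (simp add: power2_norm_eq_inner inner_diff_left inner_diff_right inner_commute)
  then have "(dist A B)\<^sup>2 + (dist A C)\<^sup>2 - (dist B C)\<^sup>2 = 2 * ((B - A) \<bullet> (C - A))"
    by (simp add: dist_norm norm_minus_commute)
  moreover have "dist A B = norm (B - A)" "dist A C = norm (C - A)"
    by (simp_all add: dist_norm norm_minus_commute)
  ultimately show ?thesis
    by (simp add: inner_angle_def)
qed

text \<open>
  The angle at \<open>i\<close> of the face \<open>f = {i, j, k}\<close>. It is symmetric in \<open>j\<close> and \<open>k\<close>, hence determined by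
  \<open>i\<close> and the set \<open>f\<close>.
\<close>

definition face_angle :: "('v set \<Rightarrow> real) \<Rightarrow> real^'v \<Rightarrow> 'v \<Rightarrow> 'v set \<Rightarrow> real" where
  "face_angle \<Phi> r i f = (THE t. \<exists>j k. f = {i, j, k} \<and>
     t = inner_angle (edge_length \<Phi> r i j) (edge_length \<Phi> r i k) (edge_length \<Phi> r j k))"

lemma face_angle_eq:
  assumes "card {i, j, k} = 3"
  shows "face_angle \<Phi> r i {i, j, k} =
           inner_angle (edge_length \<Phi> r i j) (edge_length \<Phi> r i k) (edge_length \<Phi> r j k)"
  unfolding face_angle_def
proof (rule the_equality)
  fix t
  assume "\<exists>j' k'. {i, j, k} = {i, j', k'} \<and>
    t = inner_angle (edge_length \<Phi> r i j') (edge_length \<Phi> r i k') (edge_length \<Phi> r j' k')"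
  then obtain j' k' where jk: "{i, j, k} = {i, j', k'}"
    and t: "t = inner_angle (edge_length \<Phi> r i j') (edge_length \<Phi> r i k') (edge_length \<Phi> r j' k')"
    by blast
  have "i \<noteq> j" "i \<noteq> k" "j \<noteq> k"
    using assms by (auto simp: card_insert_if split: if_splits)
  then have "j' = j \<and> k' = k \<or> j' = k \<and> k' = j"
    using jk by (auto simp: set_eq_iff) metis+
  then show "t = inner_angle (edge_length \<Phi> r i j) (edge_length \<Phi> r i k) (edge_length \<Phi> r j k)"
    using t by (auto simp: inner_angle_def edge_length_def insert_commute ac_simps)
qed blast

definition gauss_curvature ::
    "'v::finite set set \<Rightarrow> ('v set \<Rightarrow> real) \<Rightarrow> real^'v \<Rightarrow> 'v \<Rightarrow> real" where
  "gauss_curvature T \<Phi> r i = 2 * pi - (\<Sum>f | f \<in> faces T \<and> i \<in> f. face_angle \<Phi> r i f)"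

definition alpha_curvature ::
    "'v::finite set set \<Rightarrow> ('v set \<Rightarrow> real) \<Rightarrow> real \<Rightarrow> real^'v \<Rightarrow> 'v \<Rightarrow> real" where
  "alpha_curvature T \<Phi> \<alpha> r i = gauss_curvature T \<Phi> r i / (r $ i) powr \<alpha>"

definition constant_alpha_curvature_metric ::
    "'v::finite set set \<Rightarrow> ('v set \<Rightarrow> real) \<Rightarrow> real \<Rightarrow> real^'v \<Rightarrow> bool" where
  "constant_alpha_curvature_metric T \<Phi> \<alpha> r \<longleftrightarrow>
     circle_packing_metric r \<and>
     (\<forall>i j. alpha_curvature T \<Phi> \<alpha> r i = alpha_curvature T \<Phi> \<alpha> r j)"

end

theory Submission
  imports Defs
begin

text \<open>
  Put \<open>\<kappa> = 2 \<pi> \<chi>(M)\<close> and, for a set \<open>J\<close> of vertices, let \<open>b\<^sub>J\<close> be the right-hand side of the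
  inequality (\<open>link_bound\<close>). Two facts about the total curvature \<open>K\<^sub>J = \<Sum>\<^sub>i\<^sub>\<in>\<^sub>J K\<^sub>i\<close> carry the proof:
  \<open>K\<^sub>J > b\<^sub>J\<close> for every nonempty proper \<open>J\<close>, and \<open>K\<^sub>J\<close> comes close to \<open>b\<^sub>J\<close> as soon as all radii in \<open>J\<close>
  are small compared with all radii outside \<open>J\<close>. Both are statements about a single face: its angles
  at its vertices in \<open>J\<close> add up to less than \<open>\<pi>\<close> if there are two of them and to less than
  \<open>\<pi> - \<Phi>(e)\<close> if there is one, \<open>e\<close> being the opposite edge, and these are the limits under the
  degeneration. To sum over the faces one needs that each edge lies in exactly two faces; strictness
  needs a face with vertices on both sides of \<open>J\<close>. The first property comes from invariance of domain,
  the second from the connectedness of \<open>M\<close>.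

  A constant \<open>\<alpha>\<close>-curvature metric \<open>r\<close> has \<open>K\<^sub>i = \<kappa> r\<^sub>i\<^sup>\<alpha> / \<Sum>\<^sub>j r\<^sub>j\<^sup>\<alpha>\<close> by Gauss--Bonnet, so the
  inequality for \<open>r\<^sup>* = r\<close> is \<open>K\<^sub>J > b\<^sub>J\<close>.

  Conversely, given \<open>r\<^sup>*\<close>, write \<open>r\<^sub>i = r\<^sup>*\<^sub>i exp v\<^sub>i\<close> and \<open>P\<^sub>i(v) = r\<^sub>i\<^sup>\<alpha> / \<Sum>\<^sub>j r\<^sub>j\<^sup>\<alpha>\<close>. The metric
  sought is a zero of the field \<open>K(v) - \<kappa> P(v)\<close>. By Brouwer's theorem it is enough that, after adding
  the term \<open>\<Sum>\<^sub>j v\<^sub>j\<close> to every component, the field points outwards on a large sphere. The pairing with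
  \<open>v\<close> splits into \<open>\<langle>K(v) - \<kappa> P(0), v\<rangle>\<close> and \<open>- \<kappa> \<langle>P(v) - P(0), v\<rangle>\<close>. The second part is nonnegative
  because \<open>P\<close> is the softmax of \<open>\<alpha> ln r\<close>, hence monotone in \<open>\<alpha> v\<close>, and \<open>\<alpha> \<chi>(M) \<le> 0\<close>. In the first part
  \<open>\<kappa> P(0)\<close> satisfies the inequalities by assumption. Sort the \<open>v\<^sub>i\<close> and sum by parts: every large gap
  in the sorted sequence separates a set \<open>J\<close> of relatively tiny circles, so
  \<open>K\<^sub>J - \<kappa> P\<^sub>J(0)\<close> is close to \<open>b\<^sub>J - \<kappa> P\<^sub>J(0) < 0\<close>, and the gap contributes a positive multiple of its
  length. The pairing therefore grows linearly with the spread \<open>max v - min v\<close>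
  (\<open>pairing_bounded_below_by_spread\<close>).
\<close>

section \<open>Invariance of domain on triangulated surfaces\<close>

lemma closed_surface_chart:
  fixes R :: "'a::topological_space set"
  assumes "closed_surface M" and "top_of_set R homeomorphic_space M" and "p \<in> R"
  obtains P \<phi> \<psi> and W :: "(real^2) set"
  where "openin (top_of_set R) P" "p \<in> P" "open W" "homeomorphism P W \<phi> \<psi>"
proof -
  obtain f where f: "homeomorphic_map (top_of_set R) M f"
    using assms(2) by (auto simp: homeomorphic_space)
  then have "f p \<in> topspace M"
    using assms(3) homeomorphic_imp_surjective_map by fastforce
  then obtain U and W :: "(real^2) set" where U: "openin M U" "f p \<in> U" "open W"
      "subtopology M U homeomorphic_space top_of_set W"
    using assms(1) unfolding closed_surface_def by blast
  define P where "P = {x \<in> R. f x \<in> U}"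
  have P: "openin (top_of_set R) P"
    unfolding P_def using openin_continuous_map_preimage[OF homeomorphic_imp_continuous_map[OF f] U(1)]
    by simp
  have "homeomorphic_map (subtopology (top_of_set R) P) (subtopology M U) f"
    by (rule homeomorphic_map_subtopologies[OF f])
       (use homeomorphic_imp_surjective_map[OF f] openin_subset[OF U(1)] in \<open>auto simp: P_def\<close>)
  then have "subtopology (top_of_set R) P homeomorphic_space top_of_set W"
    using U(4) homeomorphic_space homeomorphic_space_trans by blast
  then have "top_of_set P homeomorphic_space top_of_set W"
    by (simp add: subtopology_subtopology P_def Int_def)
  then obtain \<phi> \<psi> where "homeomorphic_maps (top_of_set P) (top_of_set W) \<phi> \<psi>"
    by (auto simp: homeomorphic_space_def)
  then have "homeomorphism P W \<phi> \<psi>"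
    by (auto simp: homeomorphic_maps_def homeomorphism_def continuous_map_subtopology_eu Pi_iff image_iff)
      metis+
  moreover have "p \<in> P" using U(2) assms(3) by (simp add: P_def)
  ultimately show ?thesis using that P U(3) by blast
qed

text \<open>
  Composing with a chart turns \<open>g\<close> into an injective continuous map from an open subset of the plane
  into the plane.
\<close>

lemma invariance_of_domain_from_surface:
  fixes R :: "'a::topological_space set" and g :: "'a \<Rightarrow> real \<times> real"
  assumes "closed_surface M" and "top_of_set R homeomorphic_space M"
    and S: "openin (top_of_set R) S" "p \<in> S"
    and g: "continuous_on S g" "inj_on g S"
  shows "g p \<in> interior (g ` S)"
proof -
  have "p \<in> R" using S openin_imp_subset by blast
  then obtain P \<phi> \<psi> and W :: "(real^2) set"
    where P: "openin (top_of_set R) P" "p \<in> P" "open W" and h: "homeomorphism P W \<phi> \<psi>"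
    by (rule closed_surface_chart[OF assms(1,2)])
  have PR: "P \<subseteq> R" using P(1) openin_imp_subset by blast
  have "openin (top_of_set P) (S \<inter> P)"
    using S(1) P(1) PR openin_subset_trans[of R "S \<inter> P" P] by (simp add: openin_Int)
  then have "openin (top_of_set W) (\<phi> ` (S \<inter> P))"
    using homeomorphism_imp_open_map[OF h] by blast
  then have op: "open (\<phi> ` (S \<inter> P))" using P(3) openin_open_trans by blast
  have inv: "\<psi> (\<phi> x) = x" if "x \<in> P" for x using h that by (simp add: homeomorphism_def)
  have "open ((g \<circ> \<psi>) ` \<phi> ` (S \<inter> P))"
  proof (rule invariance_of_domain_gen[OF op])
    have "continuous_on (\<phi> ` (S \<inter> P)) \<psi>"
      by (rule continuous_on_subset[of W]) (use h in \<open>auto simp: homeomorphism_def\<close>)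
    moreover have "\<psi> ` \<phi> ` (S \<inter> P) \<subseteq> S" by (auto simp: inv)
    ultimately show "continuous_on (\<phi> ` (S \<inter> P)) (g \<circ> \<psi>)"
      using continuous_on_compose continuous_on_subset[OF g(1)] by blast
    show "inj_on (g \<circ> \<psi>) (\<phi> ` (S \<inter> P))"
      using g(2) by (auto simp: inj_on_def inv)
    show "DIM(real \<times> real) \<le> DIM(real ^ 2)" by simp
  qed
  moreover have "(g \<circ> \<psi>) ` \<phi> ` (S \<inter> P) = g ` (S \<inter> P)"
    by (auto simp: inv image_iff)
  ultimately have "open (g ` (S \<inter> P))" by simp
  then show ?thesis
    by (rule interiorI) (use S(2) P(2) in auto)
qed

lemma invariance_of_domain_into_surface:
  fixes R :: "'a::t2_space set" and q :: "real \<times> real \<Rightarrow> 'a"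
  assumes "closed_surface M" and "top_of_set R homeomorphic_space M"
    and V: "open V" "v \<in> V"
    and q: "continuous_on V q" "inj_on q V" "q ` V \<subseteq> R"
  obtains S where "openin (top_of_set R) S" "q v \<in> S" "S \<subseteq> q ` V"
proof -
  have "q v \<in> R" using V(2) q(3) by (simp add: image_subset_iff)
  then obtain P \<phi> \<psi> and W :: "(real^2) set"
    where P: "openin (top_of_set R) P" "q v \<in> P" "open W" and h: "homeomorphism P W \<phi> \<psi>"
    by (rule closed_surface_chart[OF assms(1,2)])
  define V' where "V' = V \<inter> q -` P"
  have "openin (top_of_set V) V'"
    unfolding V'_def by (rule continuous_openin_preimage[of V q R P]) (use q P(1) in auto)
  then have V': "open V'" using V(1) openin_open_trans by blast
  have inv: "\<psi> (\<phi> x) = x" if "x \<in> P" for x using h that by (simp add: homeomorphism_def)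
  have "open ((\<phi> \<circ> q) ` V')"
  proof (rule invariance_of_domain_gen[OF V'])
    have "continuous_on V' q"
      by (rule continuous_on_subset[OF q(1)]) (simp add: V'_def)
    moreover have "continuous_on (q ` V') \<phi>"
      by (rule continuous_on_subset[OF homeomorphism_cont1[OF h]]) (auto simp: V'_def)
    ultimately show "continuous_on V' (\<phi> \<circ> q)" by (rule continuous_on_compose)
    show "inj_on (\<phi> \<circ> q) V'"
      by (rule inj_onI) (metis (no_types) IntE V'_def comp_apply inj_onD inv q(2) vimageE)
    show "DIM(real ^ 2) \<le> DIM(real \<times> real)" by simp
  qed
  moreover have "(\<phi> \<circ> q) ` V' \<subseteq> W"
    using h by (auto simp: V'_def homeomorphism_def)
  ultimately have "openin (top_of_set W) ((\<phi> \<circ> q) ` V')" using P(3) openin_open_eq by blast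
  then have "openin (top_of_set P) (\<psi> ` (\<phi> \<circ> q) ` V')"
    using homeomorphism_imp_open_map[OF homeomorphism_symD[OF h]] by blast
  moreover have "\<psi> ` (\<phi> \<circ> q) ` V' = q ` V'"
    by (auto simp: V'_def inv image_iff) (metis IntI inv vimageI)+
  ultimately have "openin (top_of_set R) (q ` V')"
    using P(1) openin_trans by fastforce
  then show ?thesis
    by (rule that) (use P(2) V(2) in \<open>auto simp: V'_def\<close>)
qed

lemma convex_hull_axes:
  fixes s :: "'v::finite set"
  shows "convex hull ((\<lambda>i. axis i 1) ` s) =
    {x :: real^'v. (\<forall>i. 0 \<le> x $ i) \<and> (\<Sum>i\<in>UNIV. x $ i) = 1 \<and> {i. x $ i \<noteq> 0} \<subseteq> s}" (is "_ = ?S")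
proof
  have "convex ?S"
  proof (rule convexI)
    fix x y :: "real^'v" and u v :: real
    assume *: "x \<in> ?S" "y \<in> ?S" "0 \<le> u" "0 \<le> v" "u + v = 1"
    have "(\<Sum>i\<in>UNIV. (u *\<^sub>R x + v *\<^sub>R y) $ i) = u * (\<Sum>i\<in>UNIV. x $ i) + v * (\<Sum>i\<in>UNIV. y $ i)"
      by (simp add: sum.distrib sum_distrib_left)
    then have "(\<Sum>i\<in>UNIV. (u *\<^sub>R x + v *\<^sub>R y) $ i) = 1"
      using * by simp
    moreover have "(u *\<^sub>R x + v *\<^sub>R y) $ i = 0" if "i \<notin> s" for i
    proof -
      have "x $ i = 0" "y $ i = 0" using * that by auto
      then show ?thesis by simp
    qed
    ultimately show "u *\<^sub>R x + v *\<^sub>R y \<in> ?S" using * by auto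
  qed
  moreover have "(\<lambda>i. axis i 1) ` s \<subseteq> ?S"
    by (auto simp: axis_def split: if_splits)
  ultimately show "convex hull ((\<lambda>i. axis i 1) ` s) \<subseteq> ?S" by (rule hull_minimal[rotated])
next
  show "?S \<subseteq> convex hull ((\<lambda>i. axis i 1) ` s)"
  proof
    fix x :: "real^'v" assume x: "x \<in> ?S"
    have 1: "(\<Sum>i\<in>s. x $ i) = 1"
      using x sum.mono_neutral_left[of UNIV s "\<lambda>i. x $ i"] by fastforce
    have "(\<Sum>i\<in>s. x $ i *\<^sub>R axis i (1::real)) = (\<Sum>i\<in>UNIV. x $ i *\<^sub>R axis i 1)"
      by (rule sum.mono_neutral_left) (use x in auto)
    also have "\<dots> = x" by (simp add: vec_eq_iff axis_def if_distrib cong: if_cong)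
    finally have "x = (\<Sum>i\<in>s. x $ i *\<^sub>R axis i (1::real))" by simp
    moreover have "(\<Sum>i\<in>s. x $ i *\<^sub>R axis i (1::real)) \<in> convex hull ((\<lambda>i. axis i 1) ` s)"
      by (rule convex_sum) (use x 1 in \<open>auto intro: hull_inc\<close>)
    ultimately show "x \<in> convex hull ((\<lambda>i. axis i 1) ` s)" by simp
  qed
qed

lemma complex2_subset:
  assumes "complex2 T" "s \<in> T" "t \<noteq> {}" "t \<subseteq> s"
  shows "t \<in> T"
proof -
  have "\<forall>s\<in>T. \<forall>t. t \<noteq> {} \<and> t \<subseteq> s \<longrightarrow> t \<in> T"
    using assms(1) unfolding complex2_def by (elim conjE)
  from bspec[OF this assms(2)] show ?thesis using assms(3,4) by simp
qed

lemma realization_iff: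
  assumes "complex2 T"
  shows "x \<in> realization T \<longleftrightarrow>
    (\<forall>i. 0 \<le> x $ i) \<and> (\<Sum>i\<in>UNIV. x $ i) = 1 \<and> {i. x $ i \<noteq> 0} \<in> T"
proof
  assume "x \<in> realization T"
  then obtain s where s: "s \<in> T" "\<forall>i. 0 \<le> x $ i" "(\<Sum>i\<in>UNIV. x $ i) = 1" "{i. x $ i \<noteq> 0} \<subseteq> s"
    unfolding realization_def convex_hull_axes by auto
  have "{i. x $ i \<noteq> 0} \<noteq> {}"
  proof
    assume "{i. x $ i \<noteq> 0} = {}"
    then have "(\<Sum>i\<in>UNIV. x $ i) = 0" by (intro sum.neutral) auto
    then show False using s(3) by simp
  qed
  then have "{i. x $ i \<noteq> 0} \<in> T"
    using complex2_subset[OF assms s(1)] s(4) by simp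
  then show "(\<forall>i. 0 \<le> x $ i) \<and> (\<Sum>i\<in>UNIV. x $ i) = 1 \<and> {i. x $ i \<noteq> 0} \<in> T"
    using s by blast
next
  assume "(\<forall>i. 0 \<le> x $ i) \<and> (\<Sum>i\<in>UNIV. x $ i) = 1 \<and> {i. x $ i \<noteq> 0} \<in> T"
  then show "x \<in> realization T"
    unfolding realization_def convex_hull_axes by (intro UN_I[of "{i. x $ i \<noteq> 0}"]) auto
qed

section \<open>Edges and faces of a triangulated closed surface\<close>

lemma face_of_simplex_over_edge:
  assumes T: "complex2 T" and s: "s \<in> T" "{a, b} \<subseteq> s" and ab: "a \<noteq> b"
    and i: "i \<in> s" "i \<noteq> a" "i \<noteq> b"
  shows "s = {a, b, i}" and "{a, b, i} \<in> faces T"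
proof -
  have "card s \<le> 3" using T s(1) unfolding complex2_def by simp
  moreover have "card {a, b, i} = 3" using ab i by simp
  ultimately show *: "s = {a, b, i}"
    using card_seteq[of s "{a, b, i}"] s(2) i(1) by simp
  show "{a, b, i} \<in> faces T"
    using s(1) \<open>card {a, b, i} = 3\<close> unfolding faces_def * by simp
qed

text \<open>
  If at most one face contained the edge, its open star would be an open segment or a half-open
  triangle. It would embed in a closed half-plane with the midpoint of the edge on the boundary line,
  so that the image of no neighbourhood of the midpoint would be open.
\<close>

lemma edge_in_at_least_two_faces:
  fixes T :: "'v::finite set set"
  assumes M: "closed_surface M" "top_of_set (realization T) homeomorphic_space M"
    and T: "complex2 T" and e: "{a, b} \<in> T" "a \<noteq> b"
  shows "\<exists>c d. c \<noteq> d \<and> {a, b, c} \<in> faces T \<and> {a, b, d} \<in> faces T"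
proof (rule ccontr)
  assume contra: "\<not> ?thesis"
  define C where "C = {c. {a, b, c} \<in> faces T}"
  have C: "c = d" if "c \<in> C" "d \<in> C" for c d
    using contra that unfolding C_def by blast
  have abC: "a \<notin> C" "b \<notin> C" by (auto simp: C_def faces_def card_insert_if)
  \<comment> \<open>The open star of the edge, its embedding in the half-plane, and the midpoint of the edge.\<close>
  define S where "S = {x \<in> realization T. 0 < x $ a \<and> 0 < x $ b}"
  define g where "g = (\<lambda>x :: real^'v. (x $ a, \<Sum>c\<in>C. x $ c))"
  define p :: "real^'v" where "p = (\<chi> i. if i = a \<or> i = b then 1/2 else 0)"
  have zero: "x $ i = 0" if x: "x \<in> S" and i: "i \<noteq> a" "i \<noteq> b" "i \<notin> C" for x i
  proof (rule ccontr)
    assume "x $ i \<noteq> 0"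
    moreover have "{j. x $ j \<noteq> 0} \<in> T" "{a, b} \<subseteq> {j. x $ j \<noteq> 0}"
      using x realization_iff[OF T, of x] by (auto simp: S_def)
    ultimately have "{a, b, i} \<in> faces T"
      using face_of_simplex_over_edge(2)[OF T, of "{j. x $ j \<noteq> 0}" a b i] e(2) i by simp
    then show False using i by (simp add: C_def)
  qed
  have sum: "x $ b = 1 - x $ a - (\<Sum>c\<in>C. x $ c)" if x: "x \<in> S" for x
  proof -
    have "1 = (\<Sum>i\<in>UNIV. x $ i)" using x realization_iff[OF T, of x] by (simp add: S_def)
    also have "\<dots> = (\<Sum>i\<in>insert a (insert b C). x $ i)"
      by (rule sum.mono_neutral_right) (use zero[OF x] in auto)
    also have "\<dots> = x $ a + (x $ b + (\<Sum>c\<in>C. x $ c))"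
      using abC e(2) by simp
    finally show ?thesis by simp
  qed
  have "openin (top_of_set (realization T)) (realization T \<inter> {x. 0 < x $ a \<and> 0 < x $ b})"
    by (intro openin_open_Int open_Collect_conj open_Collect_less continuous_intros)
  then have "openin (top_of_set (realization T)) S"
    by (simp add: S_def Int_def)
  moreover have "p \<in> S"
  proof -
    have "(\<Sum>i\<in>UNIV. p $ i) = (\<Sum>i\<in>{a, b}. p $ i)"
      by (rule sum.mono_neutral_right) (auto simp: p_def)
    then have "(\<Sum>i\<in>UNIV. p $ i) = 1" using e(2) by (simp add: p_def)
    moreover have "{i. p $ i \<noteq> 0} = {a, b}" by (auto simp: p_def)
    ultimately show ?thesis
      using e realization_iff[OF T, of p] by (auto simp: S_def p_def)
  qed
  moreover have "continuous_on S g" unfolding g_def by (intro continuous_intros)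
  moreover have "inj_on g S"
  proof (rule inj_onI)
    fix x y assume x: "x \<in> S" and y: "y \<in> S" and "g x = g y"
    then have eq: "x $ a = y $ a" "(\<Sum>c\<in>C. x $ c) = (\<Sum>c\<in>C. y $ c)" by (auto simp: g_def)
    have "x $ i = y $ i" for i
    proof -
      consider "i = a" | "i = b" | "i \<in> C" | "i \<noteq> a" "i \<noteq> b" "i \<notin> C" by blast
      then show ?thesis
      proof cases
        case 2 then show ?thesis using sum[OF x] sum[OF y] eq by simp
      next
        case 3 then have "C = {i}" using C by blast
        then show ?thesis using eq(2) by simp
      next
        case 4 then show ?thesis using zero[OF x] zero[OF y] by simp
      qed (use eq in simp)
    qed
    then show "x = y" by (simp add: vec_eq_iff)
  qed
  ultimately have "g p \<in> interior (g ` S)"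
    by (rule invariance_of_domain_from_surface[OF M])
  then obtain \<epsilon> where \<epsilon>: "\<epsilon> > 0" "ball (g p) \<epsilon> \<subseteq> g ` S"
    using mem_interior by blast
  have "(\<Sum>c\<in>C. p $ c) = 0"
    by (rule sum.neutral) (use abC in \<open>auto simp: p_def\<close>)
  then have gp: "g p = (1/2, 0)" by (simp add: g_def p_def)
  have "dist (g p) (1/2, -\<epsilon>/2) = \<epsilon>/2" using \<epsilon> by (simp add: gp dist_Pair_Pair dist_real_def)
  then have "(1/2, -\<epsilon>/2) \<in> ball (g p) \<epsilon>" using \<epsilon> by simp
  then obtain x where x: "x \<in> S" "g x = (1/2, -\<epsilon>/2)" using \<epsilon>(2) by (metis (no_types) imageE subsetD)
  have "(\<Sum>c\<in>C. x $ c) \<ge> 0"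
    by (rule sum_nonneg) (use x(1) realization_iff[OF T, of x] in \<open>auto simp: S_def\<close>)
  then show False using x(2) \<epsilon>(1) by (simp add: g_def)
qed

text \<open>
  Two faces on a common edge already contain an open disc about the midpoint of the edge, and by
  invariance of domain this disc is a neighbourhood of the midpoint in the surface. A third face on
  the same edge would have points in every neighbourhood of the midpoint, none of them in the disc.
\<close>

lemma edge_in_at_most_two_faces:
  fixes T :: "'v::finite set set"
  assumes M: "closed_surface M" "top_of_set (realization T) homeomorphic_space M"
    and T: "complex2 T" and e: "a \<noteq> b"
    and c: "{a, b, c1} \<in> faces T" "{a, b, c2} \<in> faces T" "{a, b, c3} \<in> faces T" "c1 \<noteq> c2"
  shows "c3 = c1 \<or> c3 = c2"
proof (rule ccontr)
  assume "\<not> ?thesis"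
  then have ne: "c3 \<noteq> c1" "c3 \<noteq> c2" by auto
  have cab: "c \<noteq> a \<and> c \<noteq> b" if "{a, b, c} \<in> faces T" for c
    using that by (auto simp: faces_def card_insert_if split: if_splits)
  note cc = cab[OF c(1)] cab[OF c(2)] cab[OF c(3)]
  have fT: "f \<in> T" if "f \<in> faces T" for f using that by (simp add: faces_def)
  \<comment> \<open>\<open>q\<close> unfolds the two faces: \<open>snd z\<close> is the weight of \<open>c1\<close> where it is positive, and minus the weight
    of \<open>c2\<close> where it is negative.\<close>
  define V where "V = {z :: real \<times> real. 0 < fst z \<and> fst z + \<bar>snd z\<bar> < 1}"
  define q :: "real \<times> real \<Rightarrow> real^'v" where
    "q = (\<lambda>z. \<chi> i. if i = a then fst z else if i = b then 1 - fst z - \<bar>snd z\<bar>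
       else if i = c1 then max (snd z) 0 else if i = c2 then max (- snd z) 0 else 0)"
  have qi: "q z $ a = fst z" "q z $ b = 1 - fst z - \<bar>snd z\<bar>" "q z $ c1 = max (snd z) 0"
    "q z $ c2 = max (- snd z) 0" "\<And>i. i \<notin> {a, b, c1, c2} \<Longrightarrow> q z $ i = 0" for z
    using e cc c(4) by (auto simp: q_def)
  have sumq: "(\<Sum>i\<in>UNIV. x $ i) = x $ a + x $ b + x $ c1 + x $ c2"
    if "\<And>i. i \<notin> {a, b, c1, c2} \<Longrightarrow> x $ i = 0" for x :: "real^'v"
  proof -
    have "(\<Sum>i\<in>UNIV. x $ i) = (\<Sum>i\<in>{a, b, c1, c2}. x $ i)"
      by (rule sum.mono_neutral_right) (use that in auto)
    moreover have "a \<noteq> c1" "b \<noteq> c1" "a \<noteq> c2" "b \<noteq> c2" using cc by auto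
    ultimately show ?thesis using e c(4) by simp
  qed
  have "open V"
    unfolding V_def by (intro open_Collect_conj open_Collect_less continuous_intros)
  moreover have v: "(1/2, 0) \<in> V" by (simp add: V_def)
  moreover have "continuous_on V q"
    unfolding q_def
  proof (intro continuous_on_vec_lambda)
    fix i
    show "continuous_on V (\<lambda>z. if i = a then fst z else if i = b then 1 - fst z - \<bar>snd z\<bar>
       else if i = c1 then max (snd z) 0 else if i = c2 then max (- snd z) 0 else 0)"
      by (cases "i = a"; cases "i = b"; cases "i = c1"; cases "i = c2";
          simp; intro continuous_intros)
  qed
  moreover have "inj_on q V"
  proof (rule inj_onI)
    fix z w assume "q z = q w"
    then have "fst z = fst w" "max (snd z) 0 = max (snd w) 0" "max (- snd z) 0 = max (- snd w) 0"
      using qi(1,3,4) by metis+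
    then show "z = w" by (auto simp: prod_eq_iff max_def split: if_splits)
  qed
  moreover have "q ` V \<subseteq> realization T"
  proof
    fix x assume "x \<in> q ` V"
    then obtain z where z: "z \<in> V" "x = q z" by blast
    have "(\<Sum>i\<in>UNIV. x $ i) = x $ a + x $ b + x $ c1 + x $ c2"
      by (rule sumq) (use qi(5)[of _ z] z(2) in simp)
    then have 1: "(\<Sum>i\<in>UNIV. x $ i) = 1"
      unfolding z(2) qi(1-4) by (simp add: max_def abs_if)
    have 2: "0 \<le> x $ i" for i
      using z(1) unfolding z(2) by (simp add: q_def V_def)
    have sub: "{i. x $ i \<noteq> 0} \<subseteq> s"
      if "s = {a, b, c1} \<and> snd z \<ge> 0 \<or> s = {a, b, c2} \<and> snd z \<le> 0" for s
    proof -
      have "x $ i = 0" if "i \<notin> s" for i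
        using that \<open>s = _ \<and> _ \<or> _\<close> unfolding z(2) q_def by auto
      then show ?thesis by blast
    qed
    have "a \<in> {i. x $ i \<noteq> 0}" using z(1) qi(1)[of z] by (simp add: V_def z(2))
    then have ne: "{i. x $ i \<noteq> 0} \<noteq> {}" by blast
    have "{i. x $ i \<noteq> 0} \<in> T"
    proof (cases "snd z \<ge> 0")
      case True
      show ?thesis by (rule complex2_subset[OF T fT[OF c(1)] ne sub]) (use True in simp)
    next
      case False
      show ?thesis by (rule complex2_subset[OF T fT[OF c(2)] ne sub]) (use False in simp)
    qed
    then show "x \<in> realization T" using 1 2 realization_iff[OF T] by blast
  qed
  ultimately obtain S where S: "openin (top_of_set (realization T)) S" "q (1/2, 0) \<in> S" "S \<subseteq> q ` V"
    by (rule invariance_of_domain_into_surface[OF M])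
  obtain U where U: "open U" "S = realization T \<inter> U"
    using S(1) unfolding openin_open by blast
  \<comment> \<open>A segment from the midpoint of the edge into the third face.\<close>
  define y where "y = (\<lambda>t. q (1/2, 0) + t *\<^sub>R (axis c3 1 - axis a 1))"
  have yi: "y t $ i = (if i = a then 1/2 - t else if i = b then 1/2 else if i = c3 then t else 0)" for t i
    using e cc ne c(4) by (auto simp: y_def q_def axis_def)
  have "(y \<longlongrightarrow> y 0) (at_right 0)"
    unfolding y_def by (intro tendsto_intros)
  moreover have "y 0 \<in> U" using S(2) U(2) by (simp add: y_def)
  ultimately have "eventually (\<lambda>t. y t \<in> U) (at_right 0)"
    using U(1) topological_tendstoD by blast
  moreover have "eventually (\<lambda>t. t \<in> {0<..<1/2}) (at_right (0::real))"
    by (rule eventually_at_right_real) simp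
  ultimately have "eventually (\<lambda>t. y t \<in> U \<and> t \<in> {0<..<1/2}) (at_right (0::real))"
    by eventually_elim simp
  then obtain t where t: "y t \<in> U" "0 < t" "t < 1/2"
    using eventually_happens[of _ "at_right (0::real)"] by auto
  have "(\<Sum>i\<in>UNIV. y t $ i) = (\<Sum>i\<in>{a, b, c3}. y t $ i)"
    by (rule sum.mono_neutral_right) (auto simp: yi)
  also have "\<dots> = 1" using e cc not_sym[OF conjunct1[OF cc(3)]] not_sym[OF conjunct2[OF cc(3)]] by (simp add: yi)
  finally have "(\<Sum>i\<in>UNIV. y t $ i) = 1" .
  moreover have "{i. y t $ i \<noteq> 0} = {a, b, c3}" using t e cc by (auto simp: yi)
  moreover have "0 \<le> y t $ i" for i using t by (simp add: yi)
  ultimately have "y t \<in> realization T" using realization_iff[OF T, of "y t"] fT[OF c(3)] by simp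
  then have "y t \<in> q ` V" using t(1) U(2) S(3) by blast
  then obtain z where "y t = q z" by blast
  then have "y t $ c3 = 0" using qi(5)[of c3 z] cc ne by simp
  then show False using t cc by (simp add: yi)
qed

lemma card_faces_over_edge:
  fixes T :: "'v::finite set set"
  assumes M: "closed_surface M" "top_of_set (realization T) homeomorphic_space M"
    and T: "complex2 T" and e: "e \<in> edges T"
  shows "card {f \<in> faces T. e \<subseteq> f} = 2"
proof -
  obtain a b where ab: "e = {a, b}" "a \<noteq> b" "{a, b} \<in> T"
    using e by (auto simp: edges_def card_2_iff)
  obtain c d where cd: "c \<noteq> d" "{a, b, c} \<in> faces T" "{a, b, d} \<in> faces T"
    using edge_in_at_least_two_faces[OF M T ab(3,2)] by blast
  have "f \<in> {{a, b, c}, {a, b, d}}" if f: "f \<in> faces T" "e \<subseteq> f" for f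
  proof -
    have "\<not> f \<subseteq> {a, b}" using f(1) card_mono[of "{a, b}" f] by (auto simp: faces_def card_insert_if split: if_splits)
    then obtain i where i: "i \<in> f" "i \<noteq> a" "i \<noteq> b" by blast
    have "f \<in> T" using f(1) by (simp add: faces_def)
    then have f2: "f = {a, b, i}"
      using face_of_simplex_over_edge(1)[OF T _ _ ab(2) i] f(2) ab(1) by simp
    then show ?thesis
      using edge_in_at_most_two_faces[OF M T ab(2) cd(2,3) _ cd(1), of i] f(1) by blast
  qed
  then have "{f \<in> faces T. e \<subseteq> f} = {{a, b, c}, {a, b, d}}"
    using cd ab(1) by blast
  moreover have "{a, b, c} \<noteq> {a, b, d}"
  proof
    assume "{a, b, c} = {a, b, d}"
    then have "d \<in> {a, b, c}" by blast
    then show False using cd(1,3) by (auto simp: faces_def card_insert_if split: if_splits)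
  qed
  ultimately show ?thesis by simp
qed

text \<open>
  If every simplex had all its vertices in \<open>J\<close> or all of them outside, the realization would split
  into two disjoint nonempty closed parts. A simplex with vertices on both sides yields such a face,
  since it contains an edge across the partition, and every edge lies in a face.
\<close>

lemma face_across_vertex_partition:
  fixes T :: "'v::finite set set"
  assumes M: "closed_surface M" "top_of_set (realization T) homeomorphic_space M"
    and T: "complex2 T" and conn: "connected_space M" and J: "J \<noteq> {}" "J \<noteq> UNIV"
  shows "\<exists>f\<in>faces T. f \<inter> J \<noteq> {} \<and> f - J \<noteq> {}"
proof (rule ccontr)
  assume contra: "\<not> ?thesis"
  have cross: "s \<inter> J = {} \<or> s - J = {}" if s: "s \<in> T" for s
  proof (rule ccontr)
    assume "\<not> ?thesis"
    then obtain a b where ab: "a \<in> s" "a \<in> J" "b \<in> s" "b \<notin> J" by blast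
    then have "{a, b} \<in> T" "a \<noteq> b" using complex2_subset[OF T s, of "{a, b}"] by auto
    from edge_in_at_least_two_faces[OF M T this] obtain c where "{a, b, c} \<in> faces T" by auto
    moreover have "{a, b, c} \<inter> J \<noteq> {}" "{a, b, c} - J \<noteq> {}" using ab by auto
    ultimately show False using contra by auto
  qed
  let ?A = "{x. \<forall>i\<in>-J. x $ i = 0} :: (real^'v) set" and ?B = "{x. \<forall>i\<in>J. x $ i = 0} :: (real^'v) set"
  have closed: "closed {x :: real^'v. \<forall>i\<in>K. x $ i = 0}" for K
  proof -
    have "{x :: real^'v. \<forall>i\<in>K. x $ i = 0} = (\<Inter>i\<in>K. {x. x $ i = 0})" by auto
    then show ?thesis by (simp add: closed_INT closed_Collect_eq continuous_on_component)
  qed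
  have "connected (realization T)"
    using conn homeomorphic_connected_space[OF M(2)]
    by (simp add: connectedin_def flip: connectedin_iff_connected)
  moreover have "realization T \<subseteq> ?A \<union> ?B"
  proof
    fix x assume "x \<in> realization T"
    then have "{i. x $ i \<noteq> 0} \<in> T" using realization_iff[OF T] by blast
    then show "x \<in> ?A \<union> ?B" using cross by blast
  qed
  moreover have "?A \<inter> ?B \<inter> realization T = {}"
  proof -
    have False if "x \<in> ?A" "x \<in> ?B" "x \<in> realization T" for x
    proof -
      have "x $ i = 0" for i using that(1,2) by blast
      then show False using that(3) realization_iff[OF T, of x] by simp
    qed
    then show ?thesis by blast
  qed
  moreover have "\<exists>x. x \<in> {x. \<forall>i\<in>K. x $ i = 0} \<inter> realization T" if "v \<notin> K" for v :: 'v and K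
  proof
    have "{v} \<in> T" using T unfolding complex2_def by blast
    moreover have "{i. axis v (1::real) $ i \<noteq> 0} = {v}" by (auto simp: axis_def split: if_splits)
    ultimately show "axis v 1 \<in> {x :: real^'v. \<forall>i\<in>K. x $ i = 0} \<inter> realization T"
      using realization_iff[OF T, of "axis v 1"] that by (auto simp: axis_def)
  qed
  ultimately show False
  proof -
    assume *: "connected (realization T)" "realization T \<subseteq> ?A \<union> ?B" "?A \<inter> ?B \<inter> realization T = {}"
      and **: "\<And>v K. v \<notin> K \<Longrightarrow> \<exists>x. x \<in> {x. \<forall>i\<in>K. x $ i = 0} \<inter> realization T"
    obtain v w where "v \<notin> -J" "w \<notin> J" using J by auto
    from **[OF this(1)] **[OF this(2)]
    have "?A \<inter> realization T \<noteq> {}" "?B \<inter> realization T \<noteq> {}" by auto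
    with connected_closedD[OF *(1) *(3,2)] closed show False by simp
  qed
qed

section \<open>Triangles of circle centres\<close>

lemma inner_angle_commute: "inner_angle b c a = inner_angle c b a"
  by (simp add: inner_angle_def ac_simps)

lemma law_of_cosines_bounds:
  fixes a b c :: real
  assumes pos: "0 < b" "0 < c" and tri: "a < b + c" "b < a + c" "c < a + b"
  shows "-1 < (b\<^sup>2 + c\<^sup>2 - a\<^sup>2) / (2 * b * c)" and "(b\<^sup>2 + c\<^sup>2 - a\<^sup>2) / (2 * b * c) < 1"
proof -
  have "0 < (b + c - a) * (b + c + a)" "0 < (a + c - b) * (a + b - c)"
    using assms by (auto intro!: mult_pos_pos)
  then have "a\<^sup>2 < (b + c)\<^sup>2" "(b - c)\<^sup>2 < a\<^sup>2"
    by (auto simp: power2_eq_square algebra_simps)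
  then show "-1 < (b\<^sup>2 + c\<^sup>2 - a\<^sup>2) / (2 * b * c)" "(b\<^sup>2 + c\<^sup>2 - a\<^sup>2) / (2 * b * c) < 1"
    using pos by (auto simp: field_simps power2_eq_square)
qed

lemma inner_angle_pos_lt_pi:
  fixes a b c :: real
  assumes "0 < b" "0 < c" and "a < b + c" "b < a + c" "c < a + b"
  shows "0 < inner_angle b c a" and "inner_angle b c a < pi"
  using law_of_cosines_bounds[OF assms] arccos_lt_bounded
  by (auto simp: inner_angle_def)

lemma sin_inner_angle:
  fixes a b c :: real
  assumes "0 < b" "0 < c" and "a < b + c" "b < a + c" "c < a + b"
  shows "sin (inner_angle b c a) =
    sqrt ((a + b + c) * (b + c - a) * (a + c - b) * (a + b - c)) / (2 * b * c)"
proof -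
  have "1 - ((b\<^sup>2 + c\<^sup>2 - a\<^sup>2) / (2 * b * c))\<^sup>2 = ((2 * b * c)\<^sup>2 - (b\<^sup>2 + c\<^sup>2 - a\<^sup>2)\<^sup>2) / (2 * b * c)\<^sup>2"
  proof -
    have "1 - (n / m)\<^sup>2 = (m\<^sup>2 - n\<^sup>2) / m\<^sup>2" if "m \<noteq> 0" for m n :: real
      using that by (simp add: diff_divide_distrib power_divide)
    then show ?thesis using assms(1,2) by simp
  qed
  also have "(2 * b * c)\<^sup>2 - (b\<^sup>2 + c\<^sup>2 - a\<^sup>2)\<^sup>2 = (a + b + c) * (b + c - a) * (a + c - b) * (a + b - c)"
    by (simp add: power2_eq_square algebra_simps)
  finally have "sqrt (1 - ((b\<^sup>2 + c\<^sup>2 - a\<^sup>2) / (2 * b * c))\<^sup>2) =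
      sqrt ((a + b + c) * (b + c - a) * (a + c - b) * (a + b - c)) / (2 * b * c)"
    using assms(1,2) by (simp add: real_sqrt_divide)
  then show ?thesis
    using law_of_cosines_bounds[OF assms] by (simp add: inner_angle_def sin_arccos)
qed

lemma cos_inner_angle:
  fixes a b c :: real
  assumes "0 < b" "0 < c" and "a < b + c" "b < a + c" "c < a + b"
  shows "cos (inner_angle b c a) = (b\<^sup>2 + c\<^sup>2 - a\<^sup>2) / (2 * b * c)"
  using law_of_cosines_bounds[OF assms] by (simp add: inner_angle_def)

text \<open>
  The law of cosines gives \<open>cos (A + B) = - cos C\<close>. As \<open>0 < A + B < 2 \<pi>\<close>, it remains to exclude
  \<open>A + B = \<pi> + C\<close>, for which the sign of \<open>sin (A + B)\<close> suffices.
\<close>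

lemma triangle_angle_sum:
  fixes a b c :: real
  assumes pos: "0 < a" "0 < b" "0 < c" and tri: "a < b + c" "b < a + c" "c < a + b"
  shows "inner_angle b c a + inner_angle a c b + inner_angle a b c = pi"
proof -
  \<comment> \<open>Heron's expression, sixteen times the square of the area.\<close>
  define D where "D = (a + b + c) * (b + c - a) * (a + c - b) * (a + b - c)"
  have D: "0 < D" using assms by (simp add: D_def)
  have D': "D = (2 * b * c)\<^sup>2 - (b\<^sup>2 + c\<^sup>2 - a\<^sup>2)\<^sup>2"
    by (simp add: D_def power2_eq_square algebra_simps)
  let ?A = "inner_angle b c a" and ?B = "inner_angle a c b" and ?C = "inner_angle a b c"
  have A: "cos ?A = (b\<^sup>2 + c\<^sup>2 - a\<^sup>2) / (2 * b * c)" "sin ?A = sqrt D / (2 * b * c)"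
    using cos_inner_angle[of b c a] sin_inner_angle[of b c a] assms by (auto simp: D_def)
  have B: "cos ?B = (a\<^sup>2 + c\<^sup>2 - b\<^sup>2) / (2 * a * c)" "sin ?B = sqrt D / (2 * a * c)"
    using cos_inner_angle[of a c b] sin_inner_angle[of a c b] assms by (auto simp: D_def ac_simps)
  have C: "cos ?C = (a\<^sup>2 + b\<^sup>2 - c\<^sup>2) / (2 * a * b)"
    using cos_inner_angle[of a b c] assms by (auto simp: ac_simps)
  have "cos (?A + ?B) = ((b\<^sup>2 + c\<^sup>2 - a\<^sup>2) * (a\<^sup>2 + c\<^sup>2 - b\<^sup>2) - D) / (4 * a * b * c\<^sup>2)"
  proof -
    have "m / (2 * b * c) * (n / (2 * a * c)) - s / (2 * b * c) * (s / (2 * a * c)) =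
        (m * n - s * s) / (4 * a * b * c\<^sup>2)" for m n s :: real
      by (simp add: diff_divide_distrib power2_eq_square ac_simps)
    moreover have "sqrt D * sqrt D = D" using D by simp
    ultimately show ?thesis unfolding cos_add A B by metis
  qed
  also have "(b\<^sup>2 + c\<^sup>2 - a\<^sup>2) * (a\<^sup>2 + c\<^sup>2 - b\<^sup>2) - D = - (2 * c\<^sup>2 * (a\<^sup>2 + b\<^sup>2 - c\<^sup>2))"
    unfolding D' by (simp add: power2_eq_square algebra_simps)
  also have "- (2 * c\<^sup>2 * (a\<^sup>2 + b\<^sup>2 - c\<^sup>2)) / (4 * a * b * c\<^sup>2) = - cos ?C"
    unfolding C using pos by (simp add: field_simps)
  finally have cosAB: "cos (?A + ?B) = - cos ?C" .
  have "sin (?A + ?B) = sqrt D / (2 * a * b)"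
    unfolding sin_add A B using pos by (simp add: field_simps power2_eq_square)
  then have sinAB: "sin (?A + ?B) > 0" using D pos by simp
  have b: "0 < ?A" "?A < pi" "0 < ?B" "?B < pi" "0 < ?C" "?C < pi"
    using inner_angle_pos_lt_pi[of b c a] inner_angle_pos_lt_pi[of a c b]
      inner_angle_pos_lt_pi[of a b c] assms by auto
  have "?A + ?B < pi"
  proof (rule ccontr)
    assume "\<not> ?A + ?B < pi"
    then have "0 \<le> sin (?A + ?B - pi)" using b by (intro sin_ge_zero) auto
    then show False using sinAB by (simp add: sin_diff)
  qed
  moreover have "cos (?A + ?B) = cos (pi - ?C)" using cosAB by simp
  ultimately have "?A + ?B = pi - ?C"
    using b cos_inj_pi[of "?A + ?B" "pi - ?C"] by simp
  then show ?thesis by simp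
qed

text \<open>
  The distance of the centres of two circles of radii \<open>x\<close> and \<open>y\<close> that meet at an angle with cosine
  \<open>c\<close>. For nonnegative \<open>c\<close> it exceeds both radii, which is what makes all triples of radii admissible.
\<close>

definition packed_length :: "real \<Rightarrow> real \<Rightarrow> real \<Rightarrow> real" where
  "packed_length x y c = sqrt (x\<^sup>2 + y\<^sup>2 + 2 * x * y * c)"

lemma packed_length_commute: "packed_length x y c = packed_length y x c"
  by (simp add: packed_length_def ac_simps)

lemma
  assumes "0 < x" "0 < y" "0 \<le> c" "c \<le> 1"
  shows packed_length_power2: "(packed_length x y c)\<^sup>2 = x\<^sup>2 + y\<^sup>2 + 2 * x * y * c"
    and packed_length_greater: "x < packed_length x y c" "y < packed_length x y c"
    and packed_length_le: "packed_length x y c \<le> x + y"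
proof -
  have 0: "0 \<le> x * y * c" and 1: "x * y * c \<le> x * y"
    using assms by (auto simp: mult_left_le)
  have sq0: "0 \<le> x\<^sup>2 + y\<^sup>2 + 2 * x * y * c" using 0 by (simp add: mult.assoc)
  then show sq: "(packed_length x y c)\<^sup>2 = x\<^sup>2 + y\<^sup>2 + 2 * x * y * c"
    by (simp add: packed_length_def)
  have nn: "0 \<le> packed_length x y c" using sq0 by (simp add: packed_length_def)
  have "x\<^sup>2 < (packed_length x y c)\<^sup>2" "y\<^sup>2 < (packed_length x y c)\<^sup>2"
    unfolding sq using 0 assms zero_less_power[of x 2] zero_less_power[of y 2] by linarith+
  then show "x < packed_length x y c" "y < packed_length x y c"
    using nn power2_less_imp_less by blast+
  have "(packed_length x y c)\<^sup>2 \<le> (x + y)\<^sup>2"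
    unfolding sq using 1 by (simp add: power2_sum)
  then show "packed_length x y c \<le> x + y"
    by (rule power2_le_imp_le) (use assms in simp)
qed

lemma packed_triangle_inequality:
  assumes "0 < x" "0 < y" "0 < z" "0 \<le> c1" "c1 \<le> 1" "0 \<le> c2" "c2 \<le> 1" "0 \<le> c3" "c3 \<le> 1"
  shows "packed_length y z c3 < packed_length x y c1 + packed_length x z c2"
  using packed_length_le[of y z c3] packed_length_greater(2)[of x y c1] packed_length_greater(2)[of x z c2]
    assms by linarith

lemma packed_triangle:
  assumes "0 < x" "0 < y" "0 < z" "0 \<le> c1" "c1 \<le> 1" "0 \<le> c2" "c2 \<le> 1" "0 \<le> c3" "c3 \<le> 1"
  shows "0 < packed_length x y c1" "0 < packed_length x z c2" "0 < packed_length y z c3"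
    and "packed_length y z c3 < packed_length x y c1 + packed_length x z c2"
    and "packed_length x y c1 < packed_length y z c3 + packed_length x z c2"
    and "packed_length x z c2 < packed_length y z c3 + packed_length x y c1"
  using packed_length_greater(1)[of x y c1] packed_length_greater(1)[of x z c2]
    packed_length_greater(1)[of y z c3] packed_triangle_inequality[of x y z c1 c2 c3]
    packed_triangle_inequality[of y z x c3 c1 c2] packed_triangle_inequality[of z x y c2 c3 c1] assms
    packed_length_commute[of x y c1] packed_length_commute[of x z c2] packed_length_commute[of y z c3]
  by auto

text \<open>
  The angle at the first of three pairwise intersecting circles of radii \<open>x\<close>, \<open>y\<close>, \<open>z\<close>. The cosines
  \<open>c1\<close>, \<open>c2\<close>, \<open>c3\<close> belong to the pairs \<open>xy\<close>, \<open>xz\<close>, \<open>yz\<close>.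
\<close>

definition packed_angle :: "real \<Rightarrow> real \<Rightarrow> real \<Rightarrow> real \<Rightarrow> real \<Rightarrow> real \<Rightarrow> real" where
  "packed_angle x y z c1 c2 c3 =
     inner_angle (packed_length x y c1) (packed_length x z c2) (packed_length y z c3)"

lemma cos_packed_angle:
  assumes "0 < x" "0 < y" "0 < z" "0 \<le> c1" "c1 \<le> 1" "0 \<le> c2" "c2 \<le> 1" "0 \<le> c3" "c3 \<le> 1"
  shows "cos (packed_angle x y z c1 c2 c3) =
    (x\<^sup>2 + x * y * c1 + x * z * c2 - y * z * c3) / (packed_length x y c1 * packed_length x z c2)"
proof -
  note t = packed_triangle[OF assms]
  have "(packed_length x y c1)\<^sup>2 + (packed_length x z c2)\<^sup>2 - (packed_length y z c3)\<^sup>2 =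
      2 * (x\<^sup>2 + x * y * c1 + x * z * c2 - y * z * c3)"
    using assms by (simp add: packed_length_power2)
  then show ?thesis
    unfolding packed_angle_def cos_inner_angle[OF t(1,2,4,5,6)] mult.assoc[of 2]
    by (metis mult_divide_mult_cancel_left zero_neq_numeral)
qed

lemma packed_angle_bounds:
  assumes "0 < x" "0 < y" "0 < z" "0 \<le> c1" "c1 \<le> 1" "0 \<le> c2" "c2 \<le> 1" "0 \<le> c3" "c3 \<le> 1"
  shows "0 < packed_angle x y z c1 c2 c3" "packed_angle x y z c1 c2 c3 < pi"
  using inner_angle_pos_lt_pi[OF packed_triangle(1,2,4,5,6)[OF assms]] by (auto simp: packed_angle_def)

lemma packed_angle_sum:
  assumes "0 < x" "0 < y" "0 < z" "0 \<le> c1" "c1 \<le> 1" "0 \<le> c2" "c2 \<le> 1" "0 \<le> c3" "c3 \<le> 1"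
  shows "packed_angle x y z c1 c2 c3 + packed_angle y x z c1 c3 c2 + packed_angle z x y c2 c3 c1 = pi"
  using triangle_angle_sum[OF packed_triangle(3,1,2)[OF assms] packed_triangle(4,5,6)[OF assms]]
  by (simp add: packed_angle_def packed_length_commute inner_angle_commute)

lemma cos_packed_angle_greater:
  assumes "0 < x" "0 < y" "0 < z" "0 \<le> c1" "c1 \<le> 1" "0 \<le> c2" "c2 \<le> 1" "0 \<le> c3" "c3 \<le> 1"
  shows "- c3 < cos (packed_angle x y z c1 c2 c3)"
proof -
  let ?p = "packed_length x y c1" and ?q = "packed_length x z c2"
  have pq: "y < ?p" "z < ?q" using assms packed_length_greater by auto
  have "y * z \<le> ?p * ?q" using pq assms by (intro mult_mono) auto
  then have "y * z * c3 \<le> ?p * ?q * c3" using assms by (intro mult_right_mono) auto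
  moreover have "- c3 * (?p * ?q) = - (?p * ?q * c3)" by simp
  moreover have "0 < x\<^sup>2" "0 \<le> x * y * c1" "0 \<le> x * z * c2" using assms by auto
  ultimately have "- c3 * (?p * ?q) < x\<^sup>2 + x * y * c1 + x * z * c2 - y * z * c3"
    by linarith
  moreover have "0 < ?p * ?q" using pq assms by (intro mult_pos_pos) auto
  ultimately show ?thesis unfolding cos_packed_angle[OF assms] by (simp add: pos_less_divide_eq)
qed

text \<open>
  The upper bound is the angle of the limit triangle in which the circle at the vertex has shrunk to
  an intersection point of the two other circles.
\<close>

lemma packed_angle_less:
  assumes "0 < x" "0 < y" "0 < z" "0 \<le> c1" "c1 \<le> 1" "0 \<le> c2" "c2 \<le> 1"
    and \<phi>: "0 \<le> \<phi>" "\<phi> \<le> pi / 2"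
  shows "packed_angle x y z c1 c2 (cos \<phi>) < pi - \<phi>"
proof (rule ccontr)
  have c3: "0 \<le> cos \<phi>" "cos \<phi> \<le> 1" using \<phi> cos_ge_zero[of \<phi>] by auto
  assume "\<not> ?thesis"
  then have "cos (packed_angle x y z c1 c2 (cos \<phi>)) \<le> cos (pi - \<phi>)"
    using packed_angle_bounds[OF assms(1-7) c3] \<phi> pi_gt_zero by (intro cos_monotone_0_pi_le) linarith+
  then show False using cos_packed_angle_greater[OF assms(1-7) c3] by simp
qed

text \<open>
  When \<open>x\<close> is negligible against \<open>y\<close> and \<open>z\<close>, the adjacent sides have lengths about \<open>y\<close> and \<open>z\<close>, and
  the cosine of the angle is about \<open>- cos \<phi>\<close>. For \<open>\<epsilon> \<le> 1\<close> the error is at most \<open>6 \<epsilon>\<close>, whatever the radii are.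
\<close>

lemma packed_angle_at_small_vertex:
  assumes \<phi>: "0 \<le> \<phi>" "\<phi> \<le> pi / 2" and "0 < \<delta>"
  shows "\<exists>\<epsilon>>0. \<forall>x y z c1 c2. 0 < x \<longrightarrow> 0 < y \<longrightarrow> 0 < z \<longrightarrow> 0 \<le> c1 \<longrightarrow> c1 \<le> 1 \<longrightarrow> 0 \<le> c2 \<longrightarrow> c2 \<le> 1 \<longrightarrow>
     x \<le> \<epsilon> * y \<longrightarrow> x \<le> \<epsilon> * z \<longrightarrow> pi - \<phi> - \<delta> < packed_angle x y z c1 c2 (cos \<phi>)"
proof -
  define c3 where "c3 = cos \<phi>"
  have c3: "0 \<le> c3" "c3 \<le> 1" using \<phi> cos_ge_zero[of \<phi>] by (auto simp: c3_def)
  have "- c3 \<in> {-1..1}" using c3 by auto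
  then obtain d where d: "0 < d"
      "\<And>q. q \<in> {-1..1} \<Longrightarrow> dist q (- c3) < d \<Longrightarrow> dist (arccos q) (arccos (- c3)) < \<delta>"
    using continuous_on_arccos' \<open>0 < \<delta>\<close> unfolding continuous_on_iff by blast
  have lim: "arccos (- c3) = pi - \<phi>"
    using \<phi> c3 by (simp add: arccos_minus c3_def arccos_cos)
  define \<epsilon> where "\<epsilon> = min 1 (d / 8)"
  have \<epsilon>: "0 < \<epsilon>" "\<epsilon> \<le> 1" "5 * \<epsilon> < d" using d(1) by (auto simp: \<epsilon>_def min_def)
  show ?thesis
  proof (intro exI[of _ \<epsilon>] conjI allI impI)
    fix x y z c1 c2 :: real
    assume xyz: "0 < x" "0 < y" "0 < z" and c: "0 \<le> c1" "c1 \<le> 1" "0 \<le> c2" "c2 \<le> 1"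
      and small: "x \<le> \<epsilon> * y" "x \<le> \<epsilon> * z"
    note as = xyz c c3
    let ?p = "packed_length x y c1" and ?q = "packed_length x z c2"
    let ?\<theta> = "packed_angle x y z c1 c2 c3"
    have pq: "y < ?p" "z < ?q" "?p \<le> x + y" "?q \<le> x + z"
      using as packed_length_greater packed_length_le by auto
    have yz: "0 < y * z" "0 < ?p * ?q" "y * z \<le> ?p * ?q"
      using pq xyz by (auto intro: mult_pos_pos mult_mono)
    have "x\<^sup>2 \<le> (\<epsilon> * y) * (\<epsilon> * z)" unfolding power2_eq_square using small xyz \<epsilon>(1) by (intro mult_mono) auto
    also have "\<dots> \<le> \<epsilon> * (y * z)"
      using mult_left_le[of \<epsilon> "\<epsilon> * (y * z)"] \<epsilon> yz(1) by (simp add: ac_simps)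
    finally have 1: "x\<^sup>2 \<le> \<epsilon> * (y * z)" .
    have "x * y * c1 \<le> x * y" "x * z * c2 \<le> x * z" using xyz c by (auto simp: mult_left_le)
    moreover have xy: "x * y \<le> \<epsilon> * (y * z)" "x * z \<le> \<epsilon> * (y * z)"
      using mult_right_mono[OF small(2), of y] mult_right_mono[OF small(1), of z] xyz by (auto simp: ac_simps)
    ultimately have 2: "x * y * c1 \<le> \<epsilon> * (y * z)" "x * z * c2 \<le> \<epsilon> * (y * z)" by auto
    have "?p * ?q \<le> (x + y) * (x + z)" using pq xyz by (intro mult_mono) auto
    also have "\<dots> = x\<^sup>2 + x * y + x * z + y * z" by (simp add: power2_eq_square algebra_simps)
    finally have 3: "?p * ?q - y * z \<le> 3 * (\<epsilon> * (y * z))" using 1 xy by simp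
    have "c3 * (?p * ?q - y * z) \<le> ?p * ?q - y * z" using c3 yz(3) by (simp add: mult_left_le_one_le)
    then have "x\<^sup>2 + x * y * c1 + x * z * c2 - y * z * c3 \<le> 6 * (\<epsilon> * (y * z)) - c3 * (?p * ?q)"
      using 1 2 3 by (simp add: algebra_simps)
    also have "\<dots> \<le> 6 * (\<epsilon> * (?p * ?q)) - c3 * (?p * ?q)" using yz(3) \<epsilon>(1) by simp
    also have "\<dots> = (6 * \<epsilon> - c3) * (?p * ?q)" by (simp add: algebra_simps)
    finally have "cos ?\<theta> \<le> 6 * \<epsilon> - c3"
      unfolding cos_packed_angle[OF as] using yz(2) by (simp add: pos_divide_le_eq)
    moreover have "- c3 < cos ?\<theta>" by (rule cos_packed_angle_greater[OF as])
    ultimately have "dist (cos ?\<theta>) (- c3) < d"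
      using \<epsilon>(1) d(1) by (simp add: dist_real_def \<epsilon>_def min_def split: if_splits)
    then have "dist (arccos (cos ?\<theta>)) (arccos (- c3)) < \<delta>" using d(2) by simp
    moreover have "arccos (cos ?\<theta>) = ?\<theta>"
      using packed_angle_bounds[OF as] by (simp add: arccos_cos)
    ultimately have "pi - \<phi> - \<delta> < ?\<theta>" by (simp add: lim dist_real_def)
    then show "pi - \<phi> - \<delta> < packed_angle x y z c1 c2 (cos \<phi>)" by (simp add: c3_def)
  qed (use \<epsilon> in auto)
qed

text \<open>
  Here both adjacent sides have length about \<open>x\<close>, and the cosine of the angle is at least
  \<open>(1 - \<epsilon>\<^sup>2) / (1 + \<epsilon>)\<^sup>2 \<ge> 1 - 2 \<epsilon>\<close> for \<open>\<epsilon> \<le> 1\<close>.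
\<close>

lemma packed_angle_at_large_vertex:
  assumes "0 < \<delta>"
  shows "\<exists>\<epsilon>>0. \<forall>x y z c1 c2 c3. 0 < x \<longrightarrow> 0 < y \<longrightarrow> 0 < z \<longrightarrow> 0 \<le> c1 \<longrightarrow> c1 \<le> 1 \<longrightarrow> 0 \<le> c2 \<longrightarrow> c2 \<le> 1 \<longrightarrow>
     0 \<le> c3 \<longrightarrow> c3 \<le> 1 \<longrightarrow> y \<le> \<epsilon> * x \<longrightarrow> z \<le> \<epsilon> * x \<longrightarrow> packed_angle x y z c1 c2 c3 < \<delta>"
proof -
  have "1 \<in> {-1..(1::real)}" by simp
  then obtain d where d: "0 < d"
      "\<And>q. q \<in> {-1..1} \<Longrightarrow> dist q 1 < d \<Longrightarrow> dist (arccos q) (arccos 1) < \<delta>"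
    using continuous_on_arccos' \<open>0 < \<delta>\<close> unfolding continuous_on_iff by blast
  define \<epsilon> where "\<epsilon> = min 1 (d / 4)"
  have \<epsilon>: "0 < \<epsilon>" "\<epsilon> \<le> 1" "2 * \<epsilon> < d" using d(1) by (auto simp: \<epsilon>_def min_def)
  show ?thesis
  proof (intro exI[of _ \<epsilon>] conjI allI impI)
    fix x y z c1 c2 c3 :: real
    assume as: "0 < x" "0 < y" "0 < z" "0 \<le> c1" "c1 \<le> 1" "0 \<le> c2" "c2 \<le> 1" "0 \<le> c3" "c3 \<le> 1"
      and small: "y \<le> \<epsilon> * x" "z \<le> \<epsilon> * x"
    let ?p = "packed_length x y c1" and ?q = "packed_length x z c2"
    let ?\<theta> = "packed_angle x y z c1 c2 c3"
    have pq: "x < ?p" "x < ?q" "?p \<le> x + y" "?q \<le> x + z"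
      using as packed_length_greater packed_length_le by auto
    have pos: "0 < ?p * ?q" using pq as by (intro mult_pos_pos) auto
    have "y * z * c3 \<le> y * z" using as by (simp add: mult_left_le)
    also have yz: "y * z \<le> (\<epsilon> * x) * (\<epsilon> * x)" using small as by (intro mult_mono) auto
    finally have "y * z * c3 \<le> (\<epsilon> * x)\<^sup>2" by (simp add: power2_eq_square)
    moreover have "0 \<le> x * y * c1" "0 \<le> x * z * c2" using as by auto
    ultimately have 1: "x\<^sup>2 - (\<epsilon> * x)\<^sup>2 \<le> x\<^sup>2 + x * y * c1 + x * z * c2 - y * z * c3"
      by linarith
    have "?p * ?q \<le> (x + \<epsilon> * x) * (x + \<epsilon> * x)" using pq as small by (intro mult_mono) auto
    then have "(1 - 2 * \<epsilon>) * (?p * ?q) \<le> x\<^sup>2 - (\<epsilon> * x)\<^sup>2"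
    proof (cases "1 - 2 * \<epsilon> \<ge> 0")
      case True
      assume "?p * ?q \<le> (x + \<epsilon> * x) * (x + \<epsilon> * x)"
      then have "(1 - 2 * \<epsilon>) * (?p * ?q) \<le> (1 - 2 * \<epsilon>) * ((x + \<epsilon> * x) * (x + \<epsilon> * x))"
        using True by (rule mult_left_mono)
      also have "\<dots> = (1 - 2 * \<epsilon>) * (1 + \<epsilon>)\<^sup>2 * x\<^sup>2" by (simp add: power2_eq_square algebra_simps)
      also have "\<dots> \<le> (1 - \<epsilon>\<^sup>2) * x\<^sup>2"
      proof (rule mult_right_mono)
        have "(1 - \<epsilon>\<^sup>2) - (1 - 2 * \<epsilon>) * (1 + \<epsilon>)\<^sup>2 = 2 * \<epsilon>\<^sup>2 * (1 + \<epsilon>)"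
          by (simp add: power2_eq_square algebra_simps)
        then show "(1 - 2 * \<epsilon>) * (1 + \<epsilon>)\<^sup>2 \<le> 1 - \<epsilon>\<^sup>2" using \<epsilon>(1) by (smt (verit) mult_nonneg_nonneg zero_le_power2)
      qed simp
      finally show ?thesis by (simp add: power_mult_distrib algebra_simps)
    next
      case False
      then have "(1 - 2 * \<epsilon>) * (?p * ?q) \<le> 0" using pos by (simp add: mult_nonpos_nonneg)
      moreover have "(\<epsilon> * x)\<^sup>2 \<le> x\<^sup>2" using \<epsilon> as by (intro power_mono) (auto simp: mult_left_le_one_le)
      ultimately show ?thesis by simp
    qed
    then have "1 - 2 * \<epsilon> \<le> cos ?\<theta>"
      unfolding cos_packed_angle[OF as] using pos 1 by (simp add: pos_le_divide_eq)
    then have "dist (cos ?\<theta>) 1 < d"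
      unfolding dist_real_def using \<epsilon>(3) d(1) cos_le_one[of ?\<theta>] by linarith
    then have "dist (arccos (cos ?\<theta>)) (arccos 1) < \<delta>" using d(2) by simp
    moreover have "arccos (cos ?\<theta>) = ?\<theta>"
      using packed_angle_bounds[OF as] by (simp add: arccos_cos)
    ultimately show "?\<theta> < \<delta>" using packed_angle_bounds[OF as] by (simp add: dist_real_def)
  qed (use \<epsilon> in auto)
qed

section \<open>Curvature sums and the link bound\<close>

text \<open>
  The limit of the sum of the angles of the face \<open>f\<close> at its vertices in \<open>J\<close>, when the radii in \<open>J\<close>
  tend to zero while the others are kept.
\<close>

definition link_angle :: "('v set \<Rightarrow> real) \<Rightarrow> 'v set \<Rightarrow> 'v set \<Rightarrow> real" where
  "link_angle \<Phi> J f =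
    (if card (f \<inter> J) = 0 then 0 else if card (f \<inter> J) = 1 then pi - \<Phi> (f - J) else pi)"

definition link_bound :: "'v::finite set set \<Rightarrow> ('v set \<Rightarrow> real) \<Rightarrow> 'v set \<Rightarrow> real" where
  "link_bound T \<Phi> J =
    - (\<Sum>(e, v)\<in>Lk T J. pi - \<Phi> e) + 2 * pi * real_of_int (euler_char (full_subcomplex T J))"

text \<open>
  The combinatorial content of a weighted triangulation of a connected closed surface, as far as it
  matters for sums of curvatures.
\<close>

locale closed_weighted_complex =
  fixes T :: "'v::finite set set" and \<Phi> :: "'v set \<Rightarrow> real"
  assumes complex: "complex2 T"
    and weight: "\<And>e. e \<in> edges T \<Longrightarrow> 0 \<le> \<Phi> e \<and> \<Phi> e \<le> pi / 2"
    and edge_faces: "\<And>e. e \<in> edges T \<Longrightarrow> card {f \<in> faces T. e \<subseteq> f} = 2"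
    and crossing_face: "\<And>J. J \<noteq> {} \<Longrightarrow> J \<noteq> UNIV \<Longrightarrow> \<exists>f\<in>faces T. f \<inter> J \<noteq> {} \<and> f - J \<noteq> {}"
begin

lemma face_subset_edge:
  assumes "f \<in> faces T" "e \<subseteq> f" "card e = 2"
  shows "e \<in> edges T"
proof -
  have "e \<noteq> {}" using assms(3) by auto
  then show ?thesis
    using complex2_subset[OF complex, of f e] assms by (auto simp: faces_def edges_def)
qed

lemma face_cases:
  assumes "f \<in> faces T" "i \<in> f"
  obtains j k where "f = {i, j, k}" "i \<noteq> j" "i \<noteq> k" "j \<noteq> k"
    "{i, j} \<in> edges T" "{i, k} \<in> edges T" "{j, k} \<in> edges T"
proof -
  have "card f = 3" using assms by (simp add: faces_def)
  then have "card (f - {i}) = 2" using assms(2) by simp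
  then obtain j k where jk: "f - {i} = {j, k}" "j \<noteq> k" by (auto simp: card_2_iff)
  then have ne: "i \<noteq> j" "i \<noteq> k" by auto
  have f: "f = {i, j, k}" using jk assms(2) by auto
  show ?thesis
    by (rule that[OF f ne jk(2)]) (use face_subset_edge[OF assms(1)] f ne jk(2) in auto)
qed

lemma cos_weight:
  assumes "e \<in> edges T"
  shows "0 \<le> cos (\<Phi> e)" "cos (\<Phi> e) \<le> 1"
  using weight[OF assms] cos_ge_zero[of "\<Phi> e"] by auto

lemma face_angle_packed:
  assumes "i \<noteq> j" "i \<noteq> k" "j \<noteq> k"
  shows "face_angle \<Phi> r i {i, j, k} =
    packed_angle (r $ i) (r $ j) (r $ k) (cos (\<Phi> {i, j})) (cos (\<Phi> {i, k})) (cos (\<Phi> {j, k}))"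
  using face_angle_eq[of i j k \<Phi> r] assms
  by (simp add: edge_length_def packed_length_def packed_angle_def)

lemma face_angle_bounds:
  assumes "circle_packing_metric r" "f \<in> faces T" "i \<in> f"
  shows "0 < face_angle \<Phi> r i f" "face_angle \<Phi> r i f < pi"
proof -
  obtain j k where f: "f = {i, j, k}" "i \<noteq> j" "i \<noteq> k" "j \<noteq> k"
    and e: "{i, j} \<in> edges T" "{i, k} \<in> edges T" "{j, k} \<in> edges T"
    using face_cases[OF assms(2,3)] .
  show "0 < face_angle \<Phi> r i f" "face_angle \<Phi> r i f < pi"
    unfolding f(1) face_angle_packed[OF f(2-4)]
    using assms(1) cos_weight[OF e(1)] cos_weight[OF e(2)] cos_weight[OF e(3)]
    by (auto intro!: packed_angle_bounds simp: circle_packing_metric_def)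
qed

lemma face_angle_sum:
  assumes "circle_packing_metric r" "f \<in> faces T"
  shows "(\<Sum>i\<in>f. face_angle \<Phi> r i f) = pi"
proof -
  have "f \<noteq> {}" using assms(2) by (auto simp: faces_def)
  then obtain i where "i \<in> f" by blast
  then obtain j k where f: "f = {i, j, k}" "i \<noteq> j" "i \<noteq> k" "j \<noteq> k"
    and e: "{i, j} \<in> edges T" "{i, k} \<in> edges T" "{j, k} \<in> edges T"
    using face_cases[OF assms(2)] by metis
  have "(\<Sum>i\<in>f. face_angle \<Phi> r i f) =
      face_angle \<Phi> r i {i, j, k} + face_angle \<Phi> r j {j, i, k} + face_angle \<Phi> r k {k, i, j}"
    using f by (simp add: insert_commute)
  also have "\<dots> = pi"
    using face_angle_packed[OF f(2-4), of r] face_angle_packed[of j i k r] face_angle_packed[of k i j r] f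
      packed_angle_sum[of "r $ i" "r $ j" "r $ k" "cos (\<Phi> {i, j})" "cos (\<Phi> {i, k})" "cos (\<Phi> {j, k})"]
      assms(1) cos_weight[OF e(1)] cos_weight[OF e(2)] cos_weight[OF e(3)]
    by (simp add: circle_packing_metric_def insert_commute)
  finally show ?thesis .
qed

lemma face_angle_less:
  assumes "circle_packing_metric r" "f \<in> faces T" "f \<inter> J = {i}"
  shows "face_angle \<Phi> r i f < pi - \<Phi> (f - J)"
proof -
  obtain j k where f: "f = {i, j, k}" "i \<noteq> j" "i \<noteq> k" "j \<noteq> k"
    and e: "{i, j} \<in> edges T" "{i, k} \<in> edges T" "{j, k} \<in> edges T"
    using face_cases[OF assms(2), of i] assms(3) by auto
  have "f - J = {j, k}" using f assms(3) by auto
  then show ?thesis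
    unfolding f(1) face_angle_packed[OF f(2-4)]
    using assms(1) cos_weight[OF e(1)] cos_weight[OF e(2)] weight[OF e(3)]
    by (auto intro!: packed_angle_less simp: circle_packing_metric_def)
qed

lemma face_inter_cases:
  assumes "f \<in> faces T"
  obtains "f \<inter> J = {}" "card (f \<inter> J) = 0"
  | i where "f \<inter> J = {i}" "card (f \<inter> J) = 1"
  | k where "k \<in> f" "f \<inter> J = f - {k}" "card (f \<inter> J) = 2"
  | "f \<inter> J = f" "card (f \<inter> J) = 3"
proof -
  have 3: "card f = 3" using assms by (simp add: faces_def)
  have "card (f \<inter> J) \<le> 3" using card_mono[of f "f \<inter> J"] 3 by simp
  then consider "card (f \<inter> J) = 0" | "card (f \<inter> J) = 1" | "card (f \<inter> J) = 2" | "card (f \<inter> J) = 3"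
    by linarith
  then show ?thesis
  proof cases
    case 1 then show ?thesis using that(1) by simp
  next
    case 2 then show ?thesis using that(2) by (metis card_1_singletonE)
  next
    case 3
    have "card (f - J) = 1" using card_Diff_subset_Int[of f J] 3 \<open>card f = 3\<close> by simp
    then obtain k where "f - J = {k}" by (metis card_1_singletonE)
    then have "k \<in> f" "f \<inter> J = f - {k}" by auto
    then show ?thesis using that(3) 3 by blast
  next
    case 4
    then have "f \<inter> J = f" using card_subset_eq[of f "f \<inter> J"] 3 by simp
    then show ?thesis using that(4) 4 by blast
  qed
qed

lemma partial_angle_sum_le:
  assumes r: "circle_packing_metric r" and f: "f \<in> faces T"
  shows "(\<Sum>i\<in>f \<inter> J. face_angle \<Phi> r i f) \<le> link_angle \<Phi> J f"
    and "f \<inter> J \<noteq> {} \<Longrightarrow> f - J \<noteq> {} \<Longrightarrow>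
      (\<Sum>i\<in>f \<inter> J. face_angle \<Phi> r i f) < link_angle \<Phi> J f"
proof -
  have "(\<Sum>i\<in>f \<inter> J. face_angle \<Phi> r i f) \<le> link_angle \<Phi> J f \<and>
    (f \<inter> J \<noteq> {} \<and> f - J \<noteq> {} \<longrightarrow> (\<Sum>i\<in>f \<inter> J. face_angle \<Phi> r i f) < link_angle \<Phi> J f)"
    using f
  proof (cases rule: face_inter_cases[where J = J])
    case 1 then show ?thesis by (simp add: link_angle_def)
  next
    case (2 i)
    then show ?thesis using face_angle_less[OF r f 2(1)] by (simp add: link_angle_def)
  next
    case (3 k)
    have "(\<Sum>i\<in>f. face_angle \<Phi> r i f) = face_angle \<Phi> r k f + (\<Sum>i\<in>f - {k}. face_angle \<Phi> r i f)"
      by (rule sum.remove) (use 3 in auto)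
    then show ?thesis
      using face_angle_sum[OF r f] face_angle_bounds[OF r f 3(1)] 3 by (simp add: link_angle_def)
  next
    case 4
    then show ?thesis using face_angle_sum[OF r f] by (auto simp: link_angle_def)
  qed
  then show "(\<Sum>i\<in>f \<inter> J. face_angle \<Phi> r i f) \<le> link_angle \<Phi> J f"
    and "f \<inter> J \<noteq> {} \<Longrightarrow> f - J \<noteq> {} \<Longrightarrow>
      (\<Sum>i\<in>f \<inter> J. face_angle \<Phi> r i f) < link_angle \<Phi> J f"
    by auto
qed

text \<open>
  The degeneration of a single face. One vertex in \<open>J\<close> is the case of a small circle between two large
  ones; for two vertices in \<open>J\<close>, the remaining angle, at the large circle, tends to zero.
\<close>

lemma partial_angle_sum_ge:
  assumes f: "f \<in> faces T" and \<delta>: "0 < \<delta>"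
  shows "\<exists>\<epsilon>>0. \<forall>r. circle_packing_metric r \<longrightarrow> (\<forall>i\<in>J. \<forall>k\<in>-J. r $ i \<le> \<epsilon> * r $ k) \<longrightarrow>
     link_angle \<Phi> J f - \<delta> < (\<Sum>i\<in>f \<inter> J. face_angle \<Phi> r i f)"
  using f
proof (cases rule: face_inter_cases[where J = J])
  case 1 then show ?thesis using \<delta> by (intro exI[of _ 1]) (simp add: link_angle_def)
next
  case (2 i)
  obtain j k where ijk: "f = {i, j, k}" "i \<noteq> j" "i \<noteq> k" "j \<noteq> k"
    and e: "{i, j} \<in> edges T" "{i, k} \<in> edges T" "{j, k} \<in> edges T"
    using face_cases[OF f, of i] 2(1) by auto
  have fJ: "f - J = {j, k}" "i \<in> J" "j \<in> -J" "k \<in> -J" using ijk 2(1) by auto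
  obtain \<epsilon> where \<epsilon>: "\<epsilon> > 0" "\<And>x y z c1 c2. 0 < x \<Longrightarrow> 0 < y \<Longrightarrow> 0 < z \<Longrightarrow> 0 \<le> c1 \<Longrightarrow> c1 \<le> 1 \<Longrightarrow> 0 \<le> c2 \<Longrightarrow> c2 \<le> 1 \<Longrightarrow>
     x \<le> \<epsilon> * y \<Longrightarrow> x \<le> \<epsilon> * z \<Longrightarrow> pi - \<Phi> {j, k} - \<delta> < packed_angle x y z c1 c2 (cos (\<Phi> {j, k}))"
    using packed_angle_at_small_vertex[of "\<Phi> {j, k}" \<delta>] weight[OF e(3)] \<delta> by blast
  show ?thesis
  proof (intro exI[of _ \<epsilon>] conjI allI impI)
    fix r :: "real^'v"
    assume r: "circle_packing_metric r" and gap: "\<forall>i\<in>J. \<forall>k\<in>-J. r $ i \<le> \<epsilon> * r $ k"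
    have "pi - \<Phi> {j, k} - \<delta> < face_angle \<Phi> r i f"
      unfolding ijk(1) face_angle_packed[OF ijk(2-4)]
      by (rule \<epsilon>(2)) (use r gap fJ cos_weight[OF e(1)] cos_weight[OF e(2)] in
        \<open>auto simp: circle_packing_metric_def\<close>)
    then show "link_angle \<Phi> J f - \<delta> < (\<Sum>i\<in>f \<inter> J. face_angle \<Phi> r i f)"
      using 2 fJ(1) by (simp add: link_angle_def)
  qed (use \<epsilon> in auto)
next
  case (3 k)
  obtain i j where kij: "f = {k, i, j}" "k \<noteq> i" "k \<noteq> j" "i \<noteq> j"
    and e: "{k, i} \<in> edges T" "{k, j} \<in> edges T" "{i, j} \<in> edges T"
    using face_cases[OF f 3(1)] .
  have fJ: "i \<in> J" "j \<in> J" "k \<in> -J" using kij 3(1,2) by auto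
  obtain \<epsilon> where \<epsilon>: "\<epsilon> > 0" "\<And>x y z c1 c2 c3. 0 < x \<Longrightarrow> 0 < y \<Longrightarrow> 0 < z \<Longrightarrow> 0 \<le> c1 \<Longrightarrow> c1 \<le> 1 \<Longrightarrow> 0 \<le> c2 \<Longrightarrow> c2 \<le> 1 \<Longrightarrow>
     0 \<le> c3 \<Longrightarrow> c3 \<le> 1 \<Longrightarrow> y \<le> \<epsilon> * x \<Longrightarrow> z \<le> \<epsilon> * x \<Longrightarrow> packed_angle x y z c1 c2 c3 < \<delta>"
    using packed_angle_at_large_vertex[OF \<delta>] by blast
  show ?thesis
  proof (intro exI[of _ \<epsilon>] conjI allI impI)
    fix r :: "real^'v"
    assume r: "circle_packing_metric r" and gap: "\<forall>i\<in>J. \<forall>k\<in>-J. r $ i \<le> \<epsilon> * r $ k"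
    have "face_angle \<Phi> r k f < \<delta>"
      unfolding kij(1) face_angle_packed[OF kij(2-4)]
      by (rule \<epsilon>(2)) (use r gap fJ cos_weight[OF e(1)] cos_weight[OF e(2)] cos_weight[OF e(3)] in
        \<open>auto simp: circle_packing_metric_def\<close>)
    moreover have "(\<Sum>i\<in>f. face_angle \<Phi> r i f) = face_angle \<Phi> r k f + (\<Sum>i\<in>f - {k}. face_angle \<Phi> r i f)"
      by (rule sum.remove) (use 3 in auto)
    ultimately show "link_angle \<Phi> J f - \<delta> < (\<Sum>i\<in>f \<inter> J. face_angle \<Phi> r i f)"
      using face_angle_sum[OF r f] 3 by (simp add: link_angle_def)
  qed (use \<epsilon> in auto)
next
  case 4
  then show ?thesis using \<delta> face_angle_sum[OF _ f] by (intro exI[of _ 1]) (simp add: link_angle_def)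
qed

lemma curvature_sum:
  "(\<Sum>i\<in>J. gauss_curvature T \<Phi> r i) =
    2 * pi * card J - (\<Sum>f\<in>faces T. \<Sum>i\<in>f \<inter> J. face_angle \<Phi> r i f)"
proof -
  have "(\<Sum>i\<in>J. \<Sum>f | f \<in> faces T \<and> i \<in> f. face_angle \<Phi> r i f) =
      (\<Sum>f\<in>faces T. \<Sum>i | i \<in> J \<and> i \<in> f. face_angle \<Phi> r i f)"
    by (rule sum.swap_restrict) auto
  also have "\<dots> = (\<Sum>f\<in>faces T. \<Sum>i\<in>f \<inter> J. face_angle \<Phi> r i f)"
    by (intro sum.cong refl) auto
  finally show ?thesis
    by (simp add: gauss_curvature_def sum_subtractf)
qed

lemma euler_char_full_subcomplex:
  "euler_char (full_subcomplex T J) =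
    int (card J) - int (card {e \<in> edges T. e \<subseteq> J}) + int (card {f \<in> faces T. f \<subseteq> J})"
proof -
  let ?V = "(\<lambda>v. {v}) ` J" and ?E = "{e \<in> edges T. e \<subseteq> J}" and ?F = "{f \<in> faces T. f \<subseteq> J}"
  have "full_subcomplex T J = ?V \<union> ?E \<union> ?F"
  proof
    show "full_subcomplex T J \<subseteq> ?V \<union> ?E \<union> ?F"
    proof
      fix s assume "s \<in> full_subcomplex T J"
      then have s: "s \<in> T" "s \<subseteq> J" by (auto simp: full_subcomplex_def)
      then have "card s \<noteq> 0" "card s \<le> 3" using complex unfolding complex2_def by auto
      then consider "card s = 1" | "card s = 2" | "card s = 3" by linarith
      then show "s \<in> ?V \<union> ?E \<union> ?F"
      proof cases
        case 1
        then obtain v where "s = {v}" by (rule card_1_singletonE)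
        then show ?thesis using s by auto
      qed (use s in \<open>auto simp: edges_def faces_def\<close>)
    qed
    have "{v} \<in> T" for v using complex unfolding complex2_def by auto
    then show "?V \<union> ?E \<union> ?F \<subseteq> full_subcomplex T J"
      by (auto simp: full_subcomplex_def edges_def faces_def)
  qed
  moreover have "?V \<inter> ?E = {}" "(?V \<union> ?E) \<inter> ?F = {}"
    by (auto simp: edges_def faces_def)
  ultimately have "euler_char (full_subcomplex T J) =
      (\<Sum>s\<in>?V. (-1) ^ (card s - 1)) + (\<Sum>s\<in>?E. (-1) ^ (card s - 1)) + (\<Sum>s\<in>?F. (-1) ^ (card s - 1))"
    by (simp add: euler_char_def sum.union_disjoint)
  also have "(\<Sum>s\<in>?V. (-1) ^ (card s - 1)) = (\<Sum>s\<in>?V. 1::int)" by (rule sum.cong) auto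
  also have "(\<Sum>s\<in>?E. (-1) ^ (card s - 1)) = (\<Sum>s\<in>?E. -1::int)" by (rule sum.cong) (auto simp: edges_def)
  also have "(\<Sum>s\<in>?F. (-1) ^ (card s - 1)) = (\<Sum>s\<in>?F. 1::int)" by (rule sum.cong) (auto simp: faces_def)
  finally show ?thesis by (simp add: card_image)
qed

text \<open>
  Counting the pairs of an edge inside \<open>J\<close> and a face containing it in both ways: an edge lies in two
  faces, and the edges of \<open>f\<close> inside \<open>J\<close> are the two-element subsets of \<open>f \<inter> J\<close>.
\<close>

lemma double_count_edges:
  "2 * card {e \<in> edges T. e \<subseteq> J} = (\<Sum>f\<in>faces T. card (f \<inter> J) choose 2)"
proof -
  have "2 * card {e \<in> edges T. e \<subseteq> J} = (\<Sum>e\<in>{e \<in> edges T. e \<subseteq> J}. card {f \<in> faces T. e \<subseteq> f})"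
    using edge_faces by simp
  also have "\<dots> = (\<Sum>e\<in>{e \<in> edges T. e \<subseteq> J}. \<Sum>f | f \<in> faces T \<and> e \<subseteq> f. 1)" by simp
  also have "\<dots> = (\<Sum>f\<in>faces T. \<Sum>e | e \<in> {e \<in> edges T. e \<subseteq> J} \<and> e \<subseteq> f. 1)"
    by (rule sum.swap_restrict) auto
  also have "\<dots> = (\<Sum>f\<in>faces T. card (f \<inter> J) choose 2)"
  proof (rule sum.cong[OF refl])
    fix f assume f: "f \<in> faces T"
    have "{e. e \<in> {e \<in> edges T. e \<subseteq> J} \<and> e \<subseteq> f} = {e. e \<subseteq> f \<inter> J \<and> card e = 2}"
      using face_subset_edge[OF f] by (auto simp: edges_def)
    then show "(\<Sum>e | e \<in> {e \<in> edges T. e \<subseteq> J} \<and> e \<subseteq> f. 1) = card (f \<inter> J) choose 2"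
      using n_subsets[of "f \<inter> J" 2] by simp
  qed
  finally show ?thesis .
qed

text \<open>
  An element \<open>(e, v)\<close> of the link is the same thing as a face \<open>e \<union> {v}\<close> that meets \<open>J\<close> in \<open>v\<close> alone.
\<close>

lemma link_sum:
  "(\<Sum>(e, v)\<in>Lk T J. pi - \<Phi> e) = (\<Sum>f | f \<in> faces T \<and> card (f \<inter> J) = 1. pi - \<Phi> (f - J))"
proof (rule sum.reindex_bij_witness[where j = "\<lambda>(e, v). insert v e" and i = "\<lambda>f. (f - J, the_elem (f \<inter> J))"])
  fix p assume "p \<in> Lk T J"
  then obtain e v where p: "p = (e, v)" "e \<in> edges T" "e \<inter> J = {}" "v \<in> J" "insert v e \<in> faces T"
    by (auto simp: Lk_def)
  have 1: "insert v e - J = e" "insert v e \<inter> J = {v}" using p by auto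
  show "(case p of (e, v) \<Rightarrow> insert v e) \<in> {f. f \<in> faces T \<and> card (f \<inter> J) = 1}"
    using p 1 by simp
  show "((case p of (e, v) \<Rightarrow> insert v e) - J, the_elem ((case p of (e, v) \<Rightarrow> insert v e) \<inter> J)) = p"
    using p(1) 1 by simp
  show "pi - \<Phi> ((case p of (e, v) \<Rightarrow> insert v e) - J) = (case p of (e, v) \<Rightarrow> pi - \<Phi> e)"
    using p(1) 1 by simp
next
  fix f assume "f \<in> {f. f \<in> faces T \<and> card (f \<inter> J) = 1}"
  then have f: "f \<in> faces T" "card (f \<inter> J) = 1" by auto
  then obtain v where v: "f \<inter> J = {v}" by (metis card_1_singletonE)
  have "card (f - J) = 2" using card_Diff_subset_Int[of f J] f by (simp add: faces_def)
  then have "f - J \<in> edges T" using face_subset_edge[OF f(1)] by blast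
  moreover have "insert v (f - J) = f" using v by auto
  moreover have "v \<in> J" using v by auto
  ultimately show "(f - J, the_elem (f \<inter> J)) \<in> Lk T J" using v f(1) by (auto simp: Lk_def)
  show "(case (f - J, the_elem (f \<inter> J)) of (e, v) \<Rightarrow> insert v e) = f"
    using v \<open>insert v (f - J) = f\<close> by simp
qed

text \<open>
  Brings the bound to the same shape as the curvature sum, so that the two can be compared face by
  face. Twice the Euler characteristic of the subcomplex is \<open>2 |J|\<close> minus the sum over the faces of
  \<open>m choose 2\<close>, lowered by two if \<open>m = 3\<close>, where \<open>m\<close> is the number of vertices in \<open>J\<close>. That summand is
  \<open>1\<close> for \<open>m \<ge> 2\<close> and \<open>0\<close> otherwise, so only the faces with \<open>m = 1\<close> need the link.
\<close>

lemma link_bound_eq: "link_bound T \<Phi> J = 2 * pi * card J - (\<Sum>f\<in>faces T. link_angle \<Phi> J f)"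
proof -
  let ?m = "\<lambda>f. card (f \<inter> J)"
  have F: "real (card {f \<in> faces T. f \<subseteq> J}) = (\<Sum>f\<in>faces T. if ?m f = 3 then 1 else 0)"
  proof -
    have "{f \<in> faces T. f \<subseteq> J} = {f \<in> faces T. ?m f = 3}"
    proof (intro Collect_cong conj_cong refl)
      fix f assume "f \<in> faces T"
      then have "card f = 3" by (simp add: faces_def)
      then show "f \<subseteq> J \<longleftrightarrow> ?m f = 3"
        using card_subset_eq[of f "f \<inter> J"] by (auto simp: Int_absorb2)
    qed
    then show ?thesis by (simp add: sum.If_cases Int_def)
  qed
  have "2 * real_of_int (euler_char (full_subcomplex T J)) =
      2 * real (card J) - real (2 * card {e \<in> edges T. e \<subseteq> J}) + 2 * real (card {f \<in> faces T. f \<subseteq> J})"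
    by (simp add: euler_char_full_subcomplex)
  also have "\<dots> = 2 * real (card J) -
      (\<Sum>f\<in>faces T. real (?m f choose 2) - 2 * (if ?m f = 3 then 1 else 0))"
    unfolding double_count_edges F by (simp add: sum_subtractf sum_distrib_left)
  finally have "2 * real_of_int (euler_char (full_subcomplex T J)) = 2 * real (card J) -
      (\<Sum>f\<in>faces T. real (?m f choose 2) - 2 * (if ?m f = 3 then 1 else 0))" (is "?l = ?a - ?s") .
  then have "pi * ?l = pi * ?a - pi * ?s" by (simp only: right_diff_distrib)
  then have "2 * pi * real_of_int (euler_char (full_subcomplex T J)) = 2 * pi * real (card J) -
      (\<Sum>f\<in>faces T. pi * (real (?m f choose 2) - 2 * (if ?m f = 3 then 1 else 0)))"
    unfolding sum_distrib_left[symmetric] by (simp only: mult_ac)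
  moreover have "(\<Sum>(e, v)\<in>Lk T J. pi - \<Phi> e) =
      (\<Sum>f\<in>faces T. if ?m f = 1 then pi - \<Phi> (f - J) else 0)"
    unfolding link_sum by (simp add: sum.If_cases Int_def)
  moreover have "(\<Sum>f\<in>faces T. if ?m f = 1 then pi - \<Phi> (f - J) else 0) +
      (\<Sum>f\<in>faces T. pi * (real (?m f choose 2) - 2 * (if ?m f = 3 then 1 else 0))) =
      (\<Sum>f\<in>faces T. link_angle \<Phi> J f)"
    unfolding sum.distrib[symmetric]
  proof (rule sum.cong[OF refl])
    fix f assume "f \<in> faces T"
    then show "(if ?m f = 1 then pi - \<Phi> (f - J) else 0) +
        pi * (real (?m f choose 2) - 2 * (if ?m f = 3 then 1 else 0)) = link_angle \<Phi> J f"
      by (cases rule: face_inter_cases[where J = J])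
        (auto simp: link_angle_def choose_two)
  qed
  ultimately show ?thesis by (simp add: link_bound_def)
qed

lemma curvature_sum_minus_link_bound:
  "(\<Sum>i\<in>J. gauss_curvature T \<Phi> r i) - link_bound T \<Phi> J =
    (\<Sum>f\<in>faces T. link_angle \<Phi> J f - (\<Sum>i\<in>f \<inter> J. face_angle \<Phi> r i f))"
  unfolding curvature_sum link_bound_eq by (simp add: sum_subtractf)

text \<open>
  The comparison with the link bound for \<open>J\<close> the set of all vertices: the angles of each face attain
  their bound \<open>\<pi>\<close>, and the link is empty.
\<close>

lemma gauss_bonnet:
  assumes "circle_packing_metric r"
  shows "(\<Sum>i\<in>UNIV. gauss_curvature T \<Phi> r i) = 2 * pi * real_of_int (euler_char T)"
proof -
  have "link_angle \<Phi> UNIV f - (\<Sum>i\<in>f \<inter> UNIV. face_angle \<Phi> r i f) = 0" if "f \<in> faces T" for f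
    using that face_angle_sum[OF assms that] by (simp add: link_angle_def faces_def)
  then have "(\<Sum>i\<in>UNIV. gauss_curvature T \<Phi> r i) - link_bound T \<Phi> UNIV = 0"
    unfolding curvature_sum_minus_link_bound by (rule sum.neutral[OF ballI])
  moreover have "Lk T UNIV = {}"
    by (auto simp: Lk_def edges_def)
  moreover have "full_subcomplex T UNIV = T" by (simp add: full_subcomplex_def)
  ultimately show ?thesis by (simp add: link_bound_def)
qed

lemma link_bound_less_curvature_sum:
  assumes r: "circle_packing_metric r" and J: "J \<noteq> {}" "J \<noteq> UNIV"
  shows "link_bound T \<Phi> J < (\<Sum>i\<in>J. gauss_curvature T \<Phi> r i)"
proof -
  obtain f where f: "f \<in> faces T" "f \<inter> J \<noteq> {}" "f - J \<noteq> {}" using crossing_face[OF J] by blast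
  have "0 < (\<Sum>f\<in>faces T. link_angle \<Phi> J f - (\<Sum>i\<in>f \<inter> J. face_angle \<Phi> r i f))"
    by (rule sum_pos2[of _ f]) (use f partial_angle_sum_le[OF r] in auto)
  then show ?thesis unfolding curvature_sum_minus_link_bound[symmetric] by simp
qed

lemma curvature_sum_degenerates:
  assumes \<delta>: "0 < \<delta>"
  shows "\<exists>\<epsilon>>0. \<forall>J r. circle_packing_metric r \<longrightarrow> (\<forall>i\<in>J. \<forall>k\<in>-J. r $ i \<le> \<epsilon> * r $ k) \<longrightarrow>
     (\<Sum>i\<in>J. gauss_curvature T \<Phi> r i) < link_bound T \<Phi> J + \<delta>"
proof -
  define \<delta>' where "\<delta>' = \<delta> / (card (faces T) + 1)"
  have \<delta>': "0 < \<delta>'" using \<delta> by (simp add: \<delta>'_def)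
  have "\<exists>\<epsilon>. 0 < \<epsilon> \<and> (\<forall>r. circle_packing_metric r \<longrightarrow> (\<forall>i\<in>J. \<forall>k\<in>-J. r $ i \<le> \<epsilon> * r $ k) \<longrightarrow>
     link_angle \<Phi> J f - \<delta>' < (\<Sum>i\<in>f \<inter> J. face_angle \<Phi> r i f))" if "f \<in> faces T" for f J
    using partial_angle_sum_ge[OF that \<delta>'] by blast
  then obtain \<epsilon>0 where \<epsilon>0: "\<And>f J. f \<in> faces T \<Longrightarrow> 0 < \<epsilon>0 f J"
    "\<And>f J r. f \<in> faces T \<Longrightarrow> circle_packing_metric r \<Longrightarrow> \<forall>i\<in>J. \<forall>k\<in>-J. r $ i \<le> \<epsilon>0 f J * r $ k \<Longrightarrow>
     link_angle \<Phi> J f - \<delta>' < (\<Sum>i\<in>f \<inter> J. face_angle \<Phi> r i f)"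
    by metis
  define \<epsilon> where "\<epsilon> = Min (insert 1 ((\<lambda>(f, J). \<epsilon>0 f J) ` (faces T \<times> UNIV)))"
  have fin: "finite (insert 1 ((\<lambda>(f, J). \<epsilon>0 f J) ` (faces T \<times> UNIV)))" by simp
  have "0 < \<epsilon>" unfolding \<epsilon>_def by (subst Min_gr_iff[OF fin]) (auto simp: \<epsilon>0(1))
  moreover have le: "\<epsilon> \<le> \<epsilon>0 f J" if "f \<in> faces T" for f J
    unfolding \<epsilon>_def by (rule Min_le[OF fin]) (use that in force)
  have "(\<Sum>i\<in>J. gauss_curvature T \<Phi> r i) < link_bound T \<Phi> J + \<delta>"
    if r: "circle_packing_metric r" and gap: "\<forall>i\<in>J. \<forall>k\<in>-J. r $ i \<le> \<epsilon> * r $ k" for J r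
  proof -
    have "link_angle \<Phi> J f - (\<Sum>i\<in>f \<inter> J. face_angle \<Phi> r i f) \<le> \<delta>'" if f: "f \<in> faces T" for f
    proof -
      have "r $ i \<le> \<epsilon>0 f J * r $ k" if "i \<in> J" "k \<in> -J" for i k
      proof -
        have "r $ i \<le> \<epsilon> * r $ k" using gap that by blast
        also have "\<dots> \<le> \<epsilon>0 f J * r $ k"
          using le[OF f] r by (intro mult_right_mono) (auto simp: circle_packing_metric_def less_imp_le)
        finally show ?thesis .
      qed
      then show ?thesis using \<epsilon>0(2)[OF f r, of J] by force
    qed
    then have "(\<Sum>f\<in>faces T. link_angle \<Phi> J f - (\<Sum>i\<in>f \<inter> J. face_angle \<Phi> r i f)) \<le> card (faces T) * \<delta>'"
      by (rule sum_bounded_above)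
    also have "\<dots> < \<delta>" using \<delta> by (simp add: \<delta>'_def field_simps)
    finally show ?thesis unfolding curvature_sum_minus_link_bound[symmetric] by simp
  qed
  ultimately show ?thesis by blast
qed

lemma curvature_bounded:
  assumes "circle_packing_metric r"
  shows "\<bar>gauss_curvature T \<Phi> r i\<bar> \<le> 2 * pi + card (faces T) * pi"
proof -
  let ?S = "\<Sum>f | f \<in> faces T \<and> i \<in> f. face_angle \<Phi> r i f"
  have "0 \<le> ?S"
    by (rule sum_nonneg) (use face_angle_bounds[OF assms] in \<open>auto simp: less_imp_le\<close>)
  moreover have "?S \<le> card {f \<in> faces T. i \<in> f} * pi"
    by (rule sum_bounded_above) (use face_angle_bounds[OF assms] in \<open>auto simp: less_imp_le\<close>)
  moreover have "card {f \<in> faces T. i \<in> f} * pi \<le> card (faces T) * pi"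
    by (intro mult_right_mono of_nat_mono card_mono) auto
  ultimately show ?thesis unfolding gauss_curvature_def using pi_ge_zero by linarith
qed

lemma continuous_gauss_curvature:
  "continuous_on {r. circle_packing_metric r} (\<lambda>r. gauss_curvature T \<Phi> r i)"
  unfolding gauss_curvature_def
proof (intro continuous_intros)
  fix f assume "f \<in> {f. f \<in> faces T \<and> i \<in> f}"
  then have "f \<in> faces T" "i \<in> f" by auto
  then obtain j k where f: "f = {i, j, k}" "i \<noteq> j" "i \<noteq> k" "j \<noteq> k"
    and e: "{i, j} \<in> edges T" "{i, k} \<in> edges T" "{j, k} \<in> edges T"
    by (rule face_cases)
  have cont: "continuous_on {r. circle_packing_metric r} (\<lambda>r. packed_length (r $ a) (r $ b) c)" for a b and c :: real
    unfolding packed_length_def by (intro continuous_intros)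
  let ?p = "\<lambda>r :: real^'v. packed_length (r $ i) (r $ j) (cos (\<Phi> {i, j}))"
    and ?q = "\<lambda>r :: real^'v. packed_length (r $ i) (r $ k) (cos (\<Phi> {i, k}))"
    and ?s = "\<lambda>r :: real^'v. packed_length (r $ j) (r $ k) (cos (\<Phi> {j, k}))"
  have t: "0 < ?p r" "0 < ?q r" "?s r < ?p r + ?q r" "?p r < ?s r + ?q r" "?q r < ?s r + ?p r"
    if "circle_packing_metric r" for r
    using packed_triangle[of "r $ i" "r $ j" "r $ k" "cos (\<Phi> {i, j})" "cos (\<Phi> {i, k})" "cos (\<Phi> {j, k})"]
      that cos_weight[OF e(1)] cos_weight[OF e(2)] cos_weight[OF e(3)]
    by (auto simp: circle_packing_metric_def)
  have "continuous_on {r. circle_packing_metric r} (\<lambda>r. inner_angle (?p r) (?q r) (?s r))"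
    unfolding inner_angle_def
  proof (intro continuous_on_arccos continuous_on_divide continuous_on_diff continuous_on_add
      continuous_on_mult continuous_on_power cont continuous_on_const ballI)
    fix r :: "real^'v" assume "r \<in> {r. circle_packing_metric r}"
    then have r: "circle_packing_metric r" by simp
    show "2 * ?p r * ?q r \<noteq> 0" using t[OF r] by simp
    show "- 1 \<le> ((?p r)\<^sup>2 + (?q r)\<^sup>2 - (?s r)\<^sup>2) / (2 * ?p r * ?q r) \<and>
      ((?p r)\<^sup>2 + (?q r)\<^sup>2 - (?s r)\<^sup>2) / (2 * ?p r * ?q r) \<le> 1"
      using law_of_cosines_bounds[of "?p r" "?q r" "?s r"] t[OF r] by simp
  qed
  then show "continuous_on {r. circle_packing_metric r} (\<lambda>r. face_angle \<Phi> r i f)"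
    unfolding f(1) face_angle_packed[OF f(2-4)] packed_angle_def .
qed

end

section \<open>Zeros of coercive fields\<close>

text \<open>
  Without a zero, \<open>v \<mapsto> - R X v / |X v|\<close> maps the ball to its boundary sphere. At a fixed point, which
  Brouwer's theorem provides, the field would point inwards.
\<close>

lemma zero_of_outward_field:
  fixes X :: "'a::euclidean_space \<Rightarrow> 'a"
  assumes R: "0 < R" and cont: "continuous_on (cball 0 R) X"
    and out: "\<And>v. norm v = R \<Longrightarrow> 0 \<le> X v \<bullet> v"
  shows "\<exists>v. X v = 0"
proof (rule ccontr)
  assume "\<nexists>v. X v = 0"
  then have nz: "X v \<noteq> 0" for v by blast
  define g where "g = (\<lambda>v. - (R / norm (X v)) *\<^sub>R X v)"
  have "continuous_on (cball 0 R) g"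
    unfolding g_def by (intro continuous_intros cont) (simp add: nz)
  moreover have "norm (g v) = R" for v using R nz[of v] by (simp add: g_def)
  then have "g \<in> cball 0 R \<rightarrow> cball 0 R" by auto
  ultimately obtain v where v: "g v = v" using brouwer_ball[OF R] by metis
  then have "norm v = R" using \<open>\<And>v. norm (g v) = R\<close>[of v] by simp
  then have "0 \<le> X v \<bullet> g v" using out[of v] v by simp
  moreover have "X v \<bullet> g v = - R * norm (X v)"
    using nz[of v] by (simp add: g_def dot_square_norm power2_eq_square)
  ultimately show False using R nz[of v] by (simp add: mult_le_0_iff)
qed

lemma abel_summation:
  fixes d w :: "nat \<Rightarrow> real"
  shows "(\<Sum>i<Suc n. d i * w i) =
    w n * (\<Sum>i<Suc n. d i) - (\<Sum>k<n. (w (Suc k) - w k) * (\<Sum>i<Suc k. d i))"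
  by (induction n) (simp_all add: algebra_simps)

lemma sorted_enumeration:
  fixes v :: "'v::finite \<Rightarrow> real"
  obtains h where "bij_betw h {..<CARD('v)} UNIV"
    "\<And>i j. i \<le> j \<Longrightarrow> j < CARD('v) \<Longrightarrow> v (h i) \<le> v (h j)"
proof -
  obtain xs0 :: "'v list" where xs0: "set xs0 = UNIV" "distinct xs0"
    using finite_distinct_list[of "UNIV :: 'v set"] by auto
  define xs where "xs = sort_key v xs0"
  have xs: "set xs = UNIV" "distinct xs" "sorted (map v xs)" using xs0 by (auto simp: xs_def)
  have len: "length xs = CARD('v)" using xs distinct_card by metis
  show ?thesis
  proof (rule that[of "\<lambda>i. xs ! i"])
    show "bij_betw ((!) xs) {..<CARD('v)} UNIV"
      by (rule bij_betw_nth) (use xs len in auto)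
    show "v (xs ! i) \<le> v (xs ! j)" if "i \<le> j" "j < CARD('v)" for i j
      using sorted_nth_mono[OF xs(3), of i j] that len by simp
  qed
qed

text \<open>
  Summation by parts along the increasing rearrangement of \<open>v\<close> writes the pairing as the sum, over
  consecutive values, of the gap times minus the sum of \<open>D\<close> over the set below the gap. Gaps of at
  least \<open>L\<close> contribute at least \<open>\<delta>\<close> times their length, by assumption; each of the other gaps costs at
  most \<open>C L\<close>.
\<close>

lemma pairing_bounded_below_by_spread:
  fixes D v :: "'v::finite \<Rightarrow> real" and L \<delta> C :: real
  assumes zero: "(\<Sum>i\<in>UNIV. D i) = 0" and L: "0 \<le> L" and \<delta>: "0 \<le> \<delta>"
    and gap: "\<And>J. J \<noteq> {} \<Longrightarrow> J \<noteq> UNIV \<Longrightarrow> \<forall>i\<in>J. \<forall>k\<in>-J. v i + L \<le> v k \<Longrightarrow> (\<Sum>i\<in>J. D i) \<le> - \<delta>"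
    and bounded: "\<And>J. \<bar>\<Sum>i\<in>J. D i\<bar> \<le> C"
  shows "\<delta> * (v a - v b) - CARD('v) * ((C + \<delta>) * L) \<le> (\<Sum>i\<in>UNIV. D i * v i)"
proof -
  obtain h where h: "bij_betw h {..<CARD('v)} UNIV"
    "\<And>i j. i \<le> j \<Longrightarrow> j < CARD('v) \<Longrightarrow> v (h i) \<le> v (h j)"
    using sorted_enumeration[of v] by blast
  obtain n where n: "CARD('v) = Suc n" using zero_less_card_finite[where 'a = 'v] gr0_implies_Suc by blast
  define w where "w = v \<circ> h"
  have C: "0 \<le> C" using bounded[of "{}"] by simp
  have reindex: "(\<Sum>i\<in>UNIV. f i) = (\<Sum>i<Suc n. f (h i))" for f :: "'v \<Rightarrow> real"
    using sum.reindex_bij_betw[OF h(1), of f] n by simp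
  have hsurj: "\<exists>i<Suc n. x = h i" for x
    using h(1) n unfolding bij_betw_def by (metis UNIV_I imageE lessThan_iff)
  have step: "\<delta> * (w (Suc k) - w k) - (C + \<delta>) * L \<le> - ((w (Suc k) - w k) * (\<Sum>i<Suc k. D (h i)))"
    if k: "k < n" for k
  proof -
    let ?J = "h ` {..<Suc k}" and ?g = "w (Suc k) - w k"
    have inj: "inj_on h {..<Suc n}" using h(1) n by (simp add: bij_betw_def)
    have S: "(\<Sum>i<Suc k. D (h i)) = (\<Sum>i\<in>?J. D i)"
      using inj_on_subset[OF inj, of "{..<Suc k}"] k by (simp add: sum.reindex)
    have g: "0 \<le> ?g" using h(2)[of k "Suc k"] k n by (simp add: w_def)
    show ?thesis
    proof (cases "L \<le> ?g")
      case True
      have "h (Suc k) \<notin> ?J" using inj_onD[OF inj, of "Suc k"] k by fastforce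
      then have "?J \<noteq> UNIV" by blast
      moreover have "v x + L \<le> v y" if xy: "x \<in> ?J" "y \<in> - ?J" for x y
      proof -
        obtain i where i: "i < Suc k" "x = h i" using xy(1) by auto
        obtain j where j: "j < Suc n" "y = h j" using hsurj by blast
        then have "Suc k \<le> j" using xy(2) by (meson ComplD imageI lessThan_iff not_less)
        then have "w (Suc k) \<le> v y" using h(2)[of "Suc k" j] j n by (simp add: w_def)
        moreover have "v x \<le> w k" using h(2)[of i k] i k n by (simp add: w_def)
        ultimately show ?thesis using True by simp
      qed
      ultimately have "(\<Sum>i\<in>?J. D i) \<le> - \<delta>" using gap[of ?J] by blast
      then have "?g * (\<Sum>i\<in>?J. D i) \<le> ?g * - \<delta>" using g by (rule mult_left_mono)
      moreover have "0 \<le> (C + \<delta>) * L" using C \<delta> L by simp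
      ultimately show ?thesis unfolding S by (simp add: mult.commute)
    next
      case False
      have "?g * (\<Sum>i\<in>?J. D i) \<le> ?g * C" using bounded[of ?J] g by (intro mult_left_mono) auto
      also have "\<dots> \<le> L * C" using False C by (intro mult_right_mono) auto
      finally have "?g * (\<Sum>i\<in>?J. D i) \<le> C * L" by (simp add: mult.commute)
      moreover have "\<delta> * ?g \<le> \<delta> * L" using False \<delta> by (intro mult_left_mono) auto
      ultimately show ?thesis unfolding S by (simp add: algebra_simps)
    qed
  qed
  have "\<delta> * (w n - w 0) - n * ((C + \<delta>) * L) = (\<Sum>k<n. \<delta> * (w (Suc k) - w k) - (C + \<delta>) * L)"
    using sum_lessThan_telescope[of w n]
    by (simp add: sum_subtractf[of "\<lambda>k. \<delta> * (w (Suc k) - w k)"] flip: sum_distrib_left)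
  also have "\<dots> \<le> (\<Sum>k<n. - ((w (Suc k) - w k) * (\<Sum>i<Suc k. D (h i))))"
    by (rule sum_mono) (use step in auto)
  also have "\<dots> = (\<Sum>i<Suc n. D (h i) * w i)"
    using abel_summation[of "\<lambda>i. D (h i)" w n] zero reindex[of D] by (simp add: sum_negf)
  also have "\<dots> = (\<Sum>i\<in>UNIV. D i * v i)" using reindex[of "\<lambda>i. D i * v i"] by (simp add: w_def)
  finally have main: "\<delta> * (w n - w 0) - n * ((C + \<delta>) * L) \<le> (\<Sum>i\<in>UNIV. D i * v i)" .
  have "w 0 \<le> v x \<and> v x \<le> w n" for x
  proof -
    obtain i where "i < Suc n" "x = h i" using hsurj by blast
    then show ?thesis using h(2)[of 0 i] h(2)[of i n] n by (simp add: w_def)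
  qed
  then have "v a - v b \<le> w n - w 0" by (meson diff_mono)
  then have "\<delta> * (v a - v b) \<le> \<delta> * (w n - w 0)" using \<delta> by (rule mult_left_mono)
  moreover have "n * ((C + \<delta>) * L) \<le> CARD('v) * ((C + \<delta>) * L)"
    using C \<delta> L n by (intro mult_right_mono) auto
  ultimately show ?thesis using main by linarith
qed

text \<open>
  With \<open>p\<close> and \<open>q\<close> the two probability vectors, \<open>a\<close> and \<open>b\<close> may be replaced by \<open>ln p\<close> and \<open>ln q\<close>: this
  changes \<open>a - b\<close> only by a constant, which pairs to zero with \<open>p - q\<close>. The claim is then the
  monotonicity of the logarithm.
\<close>

lemma softmax_monotone:
  fixes a b :: "'v::finite \<Rightarrow> real"
  shows "0 \<le> (\<Sum>i\<in>UNIV. (exp (a i) / (\<Sum>j\<in>UNIV. exp (a j)) - exp (b i) / (\<Sum>j\<in>UNIV. exp (b j))) * (a i - b i))"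
proof -
  define A B where "A = (\<Sum>j\<in>UNIV. exp (a j))" and "B = (\<Sum>j\<in>UNIV. exp (b j))"
  have AB: "0 < A" "0 < B" by (auto simp: A_def B_def intro!: sum_pos)
  define p q where "p = (\<lambda>i. exp (a i) / A)" and "q = (\<lambda>i. exp (b i) / B)"
  have pq: "0 < p i" "0 < q i" for i using AB by (auto simp: p_def q_def)
  have one: "(\<Sum>i\<in>UNIV. p i) = 1" "(\<Sum>i\<in>UNIV. q i) = 1"
    using AB by (auto simp: p_def q_def simp flip: sum_divide_distrib) (auto simp: A_def B_def)
  have ln: "ln (p i) = a i - ln A" "ln (q i) = b i - ln B" for i
    using AB by (auto simp: p_def q_def ln_div)
  have "0 \<le> (\<Sum>i\<in>UNIV. (p i - q i) * (ln (p i) - ln (q i)))"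
  proof (rule sum_nonneg)
    fix i
    show "0 \<le> (p i - q i) * (ln (p i) - ln (q i))"
      using pq[of i] by (cases "p i \<le> q i") (auto simp: mult_nonpos_nonpos)
  qed
  also have "\<dots> = (\<Sum>i\<in>UNIV. (p i - q i) * (a i - b i) - (p i - q i) * (ln A - ln B))"
    by (rule sum.cong) (auto simp: ln algebra_simps)
  also have "\<dots> = (\<Sum>i\<in>UNIV. (p i - q i) * (a i - b i)) - ((\<Sum>i\<in>UNIV. p i) - (\<Sum>i\<in>UNIV. q i)) * (ln A - ln B)"
    by (simp add: sum_subtractf flip: sum_distrib_right)
  finally have "0 \<le> (\<Sum>i\<in>UNIV. (p i - q i) * (a i - b i))" unfolding one by simp
  then show ?thesis unfolding p_def q_def A_def B_def .
qed

section \<open>Metrics of constant curvature\<close>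

context closed_weighted_complex
begin

text \<open>
  The unknown metric is \<open>r\<^sub>i = s\<^sub>i exp v\<^sub>i\<close>. The field \<open>X\<close> carries the extra term \<open>\<Sum>\<^sub>j v\<^sub>j\<close> in every component
  because curvature and target are invariant under scaling, so that the plain difference gives no
  control along the constant vectors. At a zero of \<open>X\<close> the extra term vanishes: curvature and target
  have the same total.
\<close>

lemma constant_curvature_if_admissible:
  assumes s: "circle_packing_metric s"
    and \<alpha>\<chi>: "\<alpha> * real_of_int (euler_char T) \<le> 0"
    and adm: "\<And>J. J \<noteq> {} \<Longrightarrow> J \<noteq> UNIV \<Longrightarrow> link_bound T \<Phi> J <
      2 * pi * real_of_int (euler_char T) *
        ((\<Sum>i\<in>J. (s $ i) powr \<alpha>) / (\<Sum>i\<in>UNIV. (s $ i) powr \<alpha>))"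
  shows "\<exists>r. constant_alpha_curvature_metric T \<Phi> \<alpha> r"
proof -
  define \<kappa> where "\<kappa> = 2 * pi * real_of_int (euler_char T)"
  define r where "r = (\<lambda>v :: real^'v. \<chi> i. s $ i * exp (v $ i))"
  define Z where "Z = (\<lambda>v. \<Sum>j\<in>UNIV. (r v $ j) powr \<alpha>)"
  define K where "K = (\<lambda>v i. gauss_curvature T \<Phi> (r v) i)"
  define P where "P = (\<lambda>v i. (r v $ i) powr \<alpha> / Z v)"
  define X where "X = (\<lambda>v :: real^'v. \<chi> i. K v i - \<kappa> * P v i + (\<Sum>j\<in>UNIV. v $ j))"
  have s_pos: "0 < s $ i" for i using s by (simp add: circle_packing_metric_def)
  have r: "circle_packing_metric (r v)" for v
    using s_pos by (simp add: circle_packing_metric_def r_def)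
  have r_pos: "0 < r v $ i" for v i using r by (simp add: circle_packing_metric_def)
  have r_nz: "r v $ i \<noteq> 0" for v i using r_pos[of v i] by simp
  have r0: "r 0 = s" by (simp add: r_def vec_eq_iff)
  have Z_pos: "0 < Z v" for v unfolding Z_def by (intro sum_pos) (auto simp: r_nz)
  have Z_nz: "Z v \<noteq> 0" for v using Z_pos[of v] by simp
  have sumP: "(\<Sum>i\<in>UNIV. P v i) = 1" for v
    using Z_pos[of v] by (simp add: P_def Z_def flip: sum_divide_distrib)
  have sumK: "(\<Sum>i\<in>UNIV. K v i) = \<kappa>" for v
    using gauss_bonnet[OF r] by (simp add: K_def \<kappa>_def)
  have cont_r: "continuous_on UNIV r"
    unfolding r_def by (intro continuous_intros continuous_on_vec_lambda)
  have "continuous_on UNIV (\<lambda>v. K v i)" for i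
    unfolding K_def
    by (rule continuous_on_compose2[OF continuous_gauss_curvature cont_r]) (use r in auto)
  moreover have "continuous_on UNIV (\<lambda>v. P v i)" for i
  proof -
    have *: "continuous_on UNIV (\<lambda>v. (r v $ j) powr \<alpha>)" for j
      by (intro continuous_on_powr continuous_on_component continuous_on_const cont_r)
        (simp_all add: r_nz)
    then have "continuous_on UNIV Z" unfolding Z_def by (intro continuous_on_sum)
    then show ?thesis
      unfolding P_def by (intro continuous_on_divide *) (simp_all add: Z_nz)
  qed
  ultimately have cont_X: "continuous_on UNIV X"
    unfolding X_def by (intro continuous_on_vec_lambda continuous_intros)

  \<comment> \<open>At most half of the slack in each of the finitely many inequalities for \<open>s\<close>; the other half absorbs
    the distance of the curvature sums from their limits. The \<open>1\<close> keeps the minimum defined if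
    there is only one vertex.\<close>
  obtain \<delta> where \<delta>: "0 < \<delta>"
    "\<And>J. J \<noteq> {} \<Longrightarrow> J \<noteq> UNIV \<Longrightarrow> link_bound T \<Phi> J + 2 * \<delta> \<le> (\<Sum>i\<in>J. \<kappa> * P 0 i)"
  proof -
    let ?slack = "\<lambda>J. (\<Sum>i\<in>J. \<kappa> * P 0 i) - link_bound T \<Phi> J"
    let ?S = "insert 1 (?slack ` {J. J \<noteq> {} \<and> J \<noteq> UNIV})"
    have fin: "finite ?S" by simp
    have "0 < ?slack J" if "J \<noteq> {}" "J \<noteq> UNIV" for J
    proof -
      have "(\<Sum>i\<in>J. \<kappa> * P 0 i) = \<kappa> * ((\<Sum>i\<in>J. (s $ i) powr \<alpha>) / (\<Sum>i\<in>UNIV. (s $ i) powr \<alpha>))"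
        by (simp add: P_def Z_def r0 sum_distrib_left sum_divide_distrib)
      then show ?thesis using adm[OF that] by (simp add: \<kappa>_def)
    qed
    then have pos: "0 < Min ?S" by (subst Min_gr_iff[OF fin]) auto
    have "link_bound T \<Phi> J + 2 * (Min ?S / 2) \<le> (\<Sum>i\<in>J. \<kappa> * P 0 i)"
      if J: "J \<noteq> {}" "J \<noteq> UNIV" for J
    proof -
      have "Min ?S \<le> ?slack J" by (rule Min_le[OF fin]) (use J in auto)
      then show ?thesis by linarith
    qed
    then show ?thesis using that[of "Min ?S / 2"] pos by simp
  qed
  obtain \<epsilon> where \<epsilon>: "0 < \<epsilon>" "\<And>J q. circle_packing_metric q \<Longrightarrow> (\<forall>i\<in>J. \<forall>k\<in>-J. q $ i \<le> \<epsilon> * q $ k) \<Longrightarrow>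
     (\<Sum>i\<in>J. gauss_curvature T \<Phi> q i) < link_bound T \<Phi> J + \<delta>"
    using curvature_sum_degenerates[OF \<delta>(1)] by blast
  \<comment> \<open>A gap of \<open>L\<close> in \<open>v\<close> forces a ratio of at most \<open>\<epsilon>\<close> between the radii, whatever the ratios in \<open>s\<close> are.\<close>
  define L where "L = Max (insert 0 (range (\<lambda>(i, k). ln (s $ i / (\<epsilon> * s $ k)))))"
  have L0: "0 \<le> L" unfolding L_def by (rule Max_ge) auto
  have L: "r v $ i \<le> \<epsilon> * r v $ k" if "v $ i + L \<le> v $ k" for v i k
  proof -
    have "ln (s $ i / (\<epsilon> * s $ k)) \<le> L" unfolding L_def by (rule Max_ge) auto
    then have "ln (s $ i / (\<epsilon> * s $ k)) \<le> v $ k - v $ i" using that by simp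
    moreover have "0 < s $ i / (\<epsilon> * s $ k)" using s_pos \<epsilon>(1) by simp
    ultimately have "s $ i / (\<epsilon> * s $ k) \<le> exp (v $ k - v $ i)"
      by (metis exp_le_cancel_iff exp_ln)
    then show ?thesis
      using s_pos[of k] \<epsilon>(1) by (simp add: r_def exp_diff field_simps)
  qed
  define C where "C = (\<Sum>i\<in>UNIV. 2 * pi + card (faces T) * pi + \<bar>\<kappa> * P 0 i\<bar>)"
  define B where "B = CARD('v) * ((C + \<delta>) * L)"

  have coercive: "\<delta> * (v $ a - v $ b) - B + (\<Sum>j\<in>UNIV. v $ j)\<^sup>2 \<le> X v \<bullet> v" for v a b
  proof -
    have "\<delta> * (v $ a - v $ b) - B \<le> (\<Sum>i\<in>UNIV. (K v i - \<kappa> * P 0 i) * v $ i)"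
      unfolding B_def
    proof (rule pairing_bounded_below_by_spread)
      show "(\<Sum>i\<in>UNIV. K v i - \<kappa> * P 0 i) = 0"
        by (simp add: sum_subtractf sumK sumP flip: sum_distrib_left)
      show "(\<Sum>i\<in>J. K v i - \<kappa> * P 0 i) \<le> - \<delta>"
        if J: "J \<noteq> {}" "J \<noteq> UNIV" "\<forall>i\<in>J. \<forall>k\<in>-J. v $ i + L \<le> v $ k" for J
      proof -
        have "(\<Sum>i\<in>J. K v i) < link_bound T \<Phi> J + \<delta>"
          unfolding K_def by (rule \<epsilon>(2)[OF r]) (use J(3) L in blast)
        then show ?thesis using \<delta>(2)[OF J(1,2)] by (simp add: sum_subtractf)
      qed
      show "\<bar>\<Sum>i\<in>J. K v i - \<kappa> * P 0 i\<bar> \<le> C" for J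
      proof -
        have "\<bar>\<Sum>i\<in>J. K v i - \<kappa> * P 0 i\<bar> \<le> (\<Sum>i\<in>J. \<bar>K v i - \<kappa> * P 0 i\<bar>)" by (rule sum_abs)
        also have "\<dots> \<le> (\<Sum>i\<in>UNIV. \<bar>K v i - \<kappa> * P 0 i\<bar>)" by (rule sum_mono2) auto
        also have "\<dots> \<le> C"
          unfolding C_def
        proof (rule sum_mono)
          fix i
          show "\<bar>K v i - \<kappa> * P 0 i\<bar> \<le> 2 * pi + card (faces T) * pi + \<bar>\<kappa> * P 0 i\<bar>"
            using curvature_bounded[OF r, of v i] abs_triangle_ineq4[of "K v i" "\<kappa> * P 0 i"]
            by (simp add: K_def)
        qed
        finally show ?thesis .
      qed
    qed (use L0 \<delta>(1) in auto)
    moreover have "\<kappa> * (\<Sum>i\<in>UNIV. (P v i - P 0 i) * v $ i) \<le> 0"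
    proof -
      have powr: "(r v $ i) powr \<alpha> = exp (\<alpha> * ln (r v $ i))" for v i
        using r_pos[of v i] by (simp add: powr_def)
      have ln: "\<alpha> * ln (r v $ i) - \<alpha> * ln (r 0 $ i) = \<alpha> * v $ i" for i
        using s_pos[of i] by (simp add: r_def ln_mult algebra_simps)
      have "0 \<le> (\<Sum>i\<in>UNIV. (P v i - P 0 i) * (\<alpha> * v $ i))"
        using softmax_monotone[of "\<lambda>i. \<alpha> * ln (r v $ i)" "\<lambda>i. \<alpha> * ln (r 0 $ i)"]
        unfolding ln powr[symmetric] by (simp add: P_def Z_def)
      then have mono: "0 \<le> \<alpha> * (\<Sum>i\<in>UNIV. (P v i - P 0 i) * v $ i)"
        by (simp add: sum_distrib_left mult_ac)
      have \<alpha>\<kappa>: "\<alpha> * \<kappa> \<le> 0" 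
        using mult_nonneg_nonpos[OF _ \<alpha>\<chi>, of "2 * pi"] by (simp add: \<kappa>_def mult_ac)
      show ?thesis
      proof (cases "\<alpha> = 0")
        case True
        then have "P v i = P 0 i" for i by (simp add: P_def Z_def r_nz)
        then show ?thesis by simp
      next
        case False
        then show ?thesis using mono \<alpha>\<kappa> by (auto simp: zero_le_mult_iff mult_le_0_iff)
      qed
    qed
    moreover have "X v \<bullet> v = (\<Sum>i\<in>UNIV. (K v i - \<kappa> * P 0 i) * v $ i)
        - \<kappa> * (\<Sum>i\<in>UNIV. (P v i - P 0 i) * v $ i) + (\<Sum>j\<in>UNIV. v $ j)\<^sup>2"
      by (simp add: inner_vec_def X_def algebra_simps sum.distrib sum_subtractf sum_distrib_left
          power2_eq_square sum_distrib_right)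
    ultimately show ?thesis by simp
  qed

  \<comment> \<open>If the pairing is negative, coercivity bounds the spread of \<open>v\<close> by \<open>B / \<delta>\<close> and the sum of its
    components by \<open>B + 1\<close>, hence every component by \<open>B + 1 + B / \<delta>\<close>.\<close>
  define R where "R = CARD('v) * (B + 1 + B / \<delta>) + 1"
  have "0 \<le> C"
    unfolding C_def by (rule sum_nonneg) simp
  then have B0: "0 \<le> B" using \<delta>(1) L0 by (simp add: B_def)
  have R0: "0 < R" unfolding R_def using B0 \<delta>(1) by (intro add_nonneg_pos) auto
  have "0 \<le> X v \<bullet> v" if v: "norm v = R" for v
  proof (rule ccontr)
    assume "\<not> 0 \<le> X v \<bullet> v"
    then have neg: "\<delta> * (v $ a - v $ b) - B + (\<Sum>j\<in>UNIV. v $ j)\<^sup>2 < 0" for a b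
      using coercive[of v a b] by linarith
    let ?m = "\<Sum>j\<in>UNIV. v $ j"
    have "?m\<^sup>2 < B" using neg[of undefined undefined] by simp
    then have m: "\<bar>?m\<bar> \<le> B + 1"
      using self_le_power[of "\<bar>?m\<bar>" 2] B0 by (cases "1 \<le> \<bar>?m\<bar>") auto
    have diff: "v $ a - v $ b \<le> B / \<delta>" for a b
    proof -
      have "\<delta> * (v $ a - v $ b) \<le> B" using neg[of a b] zero_le_power2[of ?m] by linarith
      then show ?thesis using \<delta>(1) by (simp add: field_simps)
    qed
    have "\<bar>v $ a\<bar> \<le> B + 1 + B / \<delta>" for a
    proof -
      have "CARD('v) * v $ a = ?m + (\<Sum>b\<in>UNIV. v $ a - v $ b)"
        by (simp add: sum_subtractf)
      moreover have "\<bar>\<Sum>b\<in>UNIV. v $ a - v $ b\<bar> \<le> CARD('v) * (B / \<delta>)"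
      proof -
        have "\<bar>\<Sum>b\<in>UNIV. v $ a - v $ b\<bar> \<le> (\<Sum>b\<in>UNIV. \<bar>v $ a - v $ b\<bar>)" by (rule sum_abs)
        also have "\<dots> \<le> CARD('v) * (B / \<delta>)"
        proof (rule sum_bounded_above)
          fix b
          show "\<bar>v $ a - v $ b\<bar> \<le> B / \<delta>" using diff[of a b] diff[of b a] by (simp add: abs_le_iff)
        qed
        finally show ?thesis .
      qed
      ultimately have "\<bar>CARD('v) * v $ a\<bar> \<le> B + 1 + CARD('v) * (B / \<delta>)" using m by linarith
      also have "\<dots> \<le> CARD('v) * (B + 1) + CARD('v) * (B / \<delta>)"
        using B0 mult_right_mono[of 1 "real CARD('v)" "B + 1"] by (simp add: Suc_leI)
      also have "\<dots> = CARD('v) * (B + 1 + B / \<delta>)" by (simp add: distrib_left)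
      finally have "real CARD('v) * \<bar>v $ a\<bar> \<le> CARD('v) * (B + 1 + B / \<delta>)" by (simp add: abs_mult)
      then show ?thesis by (rule mult_left_le_imp_le) simp
    qed
    then have "(\<Sum>a\<in>UNIV. \<bar>v $ a\<bar>) \<le> CARD('v) * (B + 1 + B / \<delta>)" by (intro sum_bounded_above)
    then show False using norm_le_l1_cart[of v] v by (simp add: R_def)
  qed
  then obtain v where v: "X v = 0"
    using zero_of_outward_field[OF R0 continuous_on_subset[OF cont_X]] by blast
  then have Xi: "K v i - \<kappa> * P v i + (\<Sum>j\<in>UNIV. v $ j) = 0" for i
    by (simp add: X_def vec_eq_iff)
  have "(\<Sum>i\<in>UNIV. K v i - \<kappa> * P v i + (\<Sum>j\<in>UNIV. v $ j)) = 0" unfolding Xi by simp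
  then have "(\<Sum>j\<in>UNIV. v $ j) = 0"
    by (simp add: sum.distrib sum_subtractf sumK sumP flip: sum_distrib_left)
  then have "K v i = \<kappa> * P v i" for i using Xi[of i] by simp
  then have "alpha_curvature T \<Phi> \<alpha> (r v) i = \<kappa> / Z v" for i
    using r_pos[of v i] by (simp add: alpha_curvature_def K_def P_def)
  then show ?thesis
    using r[of v] unfolding constant_alpha_curvature_metric_def by (intro exI[of _ "r v"]) simp
qed

lemma admissible_if_constant_curvature:
  assumes r: "constant_alpha_curvature_metric T \<Phi> \<alpha> r" and J: "J \<noteq> {}" "J \<noteq> UNIV"
  shows "link_bound T \<Phi> J < 2 * pi * real_of_int (euler_char T) *
        ((\<Sum>i\<in>J. (r $ i) powr \<alpha>) / (\<Sum>i\<in>UNIV. (r $ i) powr \<alpha>))"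
proof -
  have cpm: "circle_packing_metric r" using r by (simp add: constant_alpha_curvature_metric_def)
  have pos: "0 < (r $ i) powr \<alpha>" for i
  proof -
    have "0 < r $ i" using cpm by (simp add: circle_packing_metric_def)
    then show ?thesis by simp
  qed
  define c where "c = alpha_curvature T \<Phi> \<alpha> r undefined"
  have "alpha_curvature T \<Phi> \<alpha> r i = c" for i
    using r by (simp add: constant_alpha_curvature_metric_def c_def)
  then have K: "gauss_curvature T \<Phi> r i = c * (r $ i) powr \<alpha>" for i
    using pos[of i] by (auto simp: alpha_curvature_def divide_eq_eq)
  have Z: "0 < (\<Sum>i\<in>UNIV. (r $ i) powr \<alpha>)" by (rule sum_pos) (use pos in auto)
  have "2 * pi * real_of_int (euler_char T) = c * (\<Sum>i\<in>UNIV. (r $ i) powr \<alpha>)"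
    using gauss_bonnet[OF cpm] by (simp add: K sum_distrib_left)
  then have "2 * pi * real_of_int (euler_char T) *
      ((\<Sum>i\<in>J. (r $ i) powr \<alpha>) / (\<Sum>i\<in>UNIV. (r $ i) powr \<alpha>)) = c * (\<Sum>i\<in>J. (r $ i) powr \<alpha>)"
    using Z by simp
  also have "\<dots> = (\<Sum>i\<in>J. gauss_curvature T \<Phi> r i)" by (simp add: K sum_distrib_left)
  finally show ?thesis using link_bound_less_curvature_sum[OF cpm J] by simp
qed

end

lemma closed_weighted_complex_of_surface:
  assumes "weighted_triangulated_surface M T \<Phi>" and "connected_space M"
  shows "closed_weighted_complex T \<Phi>"
proof -
  have M: "closed_surface M" "top_of_set (realization T) homeomorphic_space M" and T: "complex2 T"
    and \<Phi>: "\<forall>e\<in>edges T. 0 \<le> \<Phi> e \<and> \<Phi> e \<le> pi / 2"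
    using assms(1) by (auto simp: weighted_triangulated_surface_def triangulates_def)
  show ?thesis
  proof
    show "complex2 T" by (rule T)
    show "0 \<le> \<Phi> e \<and> \<Phi> e \<le> pi / 2" if "e \<in> edges T" for e using \<Phi> that by blast
    show "card {f \<in> faces T. e \<subseteq> f} = 2" if "e \<in> edges T" for e
      by (rule card_faces_over_edge[OF M T that])
    show "\<exists>f\<in>faces T. f \<inter> J \<noteq> {} \<and> f - J \<noteq> {}" if "J \<noteq> {}" "J \<noteq> UNIV" for J
      by (rule face_across_vertex_partition[OF M T assms(2) that])
  qed
qed

theorem theorem2p9:
  fixes M :: "'m topology"
    and T :: "'v::finite set set"
    and \<Phi> :: "'v set \<Rightarrow> real"
    and \<alpha> :: real
  assumes "weighted_triangulated_surface M T \<Phi>"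
    and "connected_space M"
    and "\<alpha> * real_of_int (euler_char T) \<le> 0"
  shows "(\<exists>r :: real^'v. constant_alpha_curvature_metric T \<Phi> \<alpha> r) \<longleftrightarrow>
    (\<exists>r :: real^'v. circle_packing_metric r \<and>
      (\<forall>I. I \<noteq> {} \<and> I \<noteq> UNIV \<longrightarrow>
        2 * pi * real_of_int (euler_char T)
            * ((\<Sum>i\<in>I. (r $ i) powr \<alpha>) / (\<Sum>i\<in>UNIV. (r $ i) powr \<alpha>))
          > - (\<Sum>(e, v)\<in>Lk T I. pi - \<Phi> e)
            + 2 * pi * real_of_int (euler_char (full_subcomplex T I))))"
proof -
  interpret closed_weighted_complex T \<Phi>
    by (rule closed_weighted_complex_of_surface[OF assms(1,2)])
  show ?thesis
    unfolding link_bound_def[symmetric]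
  proof
    assume "\<exists>r. constant_alpha_curvature_metric T \<Phi> \<alpha> r"
    then obtain r where r: "constant_alpha_curvature_metric T \<Phi> \<alpha> r" by blast
    then have "circle_packing_metric r" by (simp add: constant_alpha_curvature_metric_def)
    then show "\<exists>r. circle_packing_metric r \<and> (\<forall>I. I \<noteq> {} \<and> I \<noteq> UNIV \<longrightarrow> link_bound T \<Phi> I <
        2 * pi * real_of_int (euler_char T)
            * ((\<Sum>i\<in>I. (r $ i) powr \<alpha>) / (\<Sum>i\<in>UNIV. (r $ i) powr \<alpha>)))"
      using admissible_if_constant_curvature[OF r] by blast
  next
    assume "\<exists>r. circle_packing_metric r \<and> (\<forall>I. I \<noteq> {} \<and> I \<noteq> UNIV \<longrightarrow> link_bound T \<Phi> I <
        2 * pi * real_of_int (euler_char T)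
            * ((\<Sum>i\<in>I. (r $ i) powr \<alpha>) / (\<Sum>i\<in>UNIV. (r $ i) powr \<alpha>)))"
    then show "\<exists>r. constant_alpha_curvature_metric T \<Phi> \<alpha> r"
    proof (elim exE conjE)
      fix r :: "real^'v"
      assume r: "circle_packing_metric r"
        and adm: "\<forall>I. I \<noteq> {} \<and> I \<noteq> UNIV \<longrightarrow> link_bound T \<Phi> I <
          2 * pi * real_of_int (euler_char T)
            * ((\<Sum>i\<in>I. (r $ i) powr \<alpha>) / (\<Sum>i\<in>UNIV. (r $ i) powr \<alpha>))"
      show ?thesis
        by (rule constant_curvature_if_admissible[OF r assms(3)]) (intro adm[rule_format] conjI)
    qed
  qed
qed

end
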